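(* Let $\Lambda$ be a $\sigma$-compact metric space and let $\sigma,\tau$ be positive diffuse Radon measures on $\Lambda$. Let $\mu_\sigma$ and $\mu_\tau$ be the Poisson measures on $\Gamma_\Lambda$ of intensity $\sigma$ and $\tau$ respectively. Assume that $\tau$ admits a density $p$ with respect to $\sigma$ such that $p-1\in L^1(\sigma)$. Then $$\mathcal{T}_{\rho_1}(\mu_\sigma,\mu_\tau)\le\int_\Lambda|p(x)-1|\,d\sigma(x).$$
   Context: $\Gamma_\Lambda=\{\omega\subset\Lambda : \omega\cap K \text{ is finite for every compact } K\}$ is the configuration space, with $\omega\in\Gamma_\Lambda$ identified with the Radon measure $\sum_{x\in\omega}\varepsilon_x$ (sum of Dirac masses). It carries the vague topology (the weakest topology making $\omega\mapsto\int_\Lambda f\,d\omega$ continuous for every continuous compactly supported $f$) and its Borel $\sigma$-algebra. The Poisson measure $\mu_\sigma$ is characterized by $\mathbb{E}_{\mu_\sigma}[\exp(\int_\Lambda f\,d\omega)]=\exp\{\int_\Lambda(e^f-1)\,d\sigma\}$ for all continuous compactly supported $f$. The total variation distance (possibly infinite) on $\Gamma_\Lambda$ is $\rho_1(\omega,\eta)=\sum_{x\in\Lambda}|\omega(\{x\})-\eta(\{x\})|$. The Rubinstein distance is $\mathcal{T}_{\rho_1}(\mu,\nu)=\inf_{\gamma}\int\int\rho_1(\omega,\eta)\,d\gamma(\omega,\eta)$, the infimum running over all probability measures $\gamma$ on $\Gamma_\Lambda\times\Gamma_\Lambda$ with marginals $\mu$ and $\nu$. *)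

theory Defs
  imports "HOL-Probability.Probability"
begin

text \<open>The underlying space is the whole type, a metric space.\<close>

definition sigma_compact_space :: "'a::metric_space itself \<Rightarrow> bool" where
  "sigma_compact_space _ \<longleftrightarrow>
     (\<exists>K :: nat \<Rightarrow> 'a set. (\<forall>n. compact (K n)) \<and> (\<Union>n. K n) = UNIV)"

text \<open>On a \<open>\<sigma>\<close>-compact metric space inner regularity, as well as finiteness on a
  neighbourhood of every point, already follows from finiteness on compact sets, so the usual
  variants of the notion of a Radon measure agree there.\<close>

definition radon_measure :: "'a::metric_space measure \<Rightarrow> bool" where
  "radon_measure \<sigma> \<longleftrightarrow>
     sets \<sigma> = sets borel \<and>
     (\<forall>K. compact K \<longrightarrow> emeasure \<sigma> K < \<infinity>) \<and>
     (\<forall>B\<in>sets borel. emeasure \<sigma> B = (SUP K\<in>{K. compact K \<and> K \<subseteq> B}. emeasure \<sigma> K))"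

definition diffuse :: "'a measure \<Rightarrow> bool" where
  "diffuse \<sigma> \<longleftrightarrow> (\<forall>x. emeasure \<sigma> {x} = 0)"

definition compactly_supported_continuous :: "('a::metric_space \<Rightarrow> real) set" where
  "compactly_supported_continuous =
     {f. continuous_on UNIV f \<and> compact (closure (support_on UNIV f))}"

definition configurations :: "'a::metric_space set set" where
  "configurations = {\<omega>. \<forall>K. compact K \<longrightarrow> finite (\<omega> \<inter> K)}"

text \<open>The sum of the Dirac masses at the points of \<open>\<omega>\<close>, obtained by pushing the
  counting measure on \<open>\<omega>\<close> forward along the inclusion.\<close>

definition config_measure :: "'a::metric_space set \<Rightarrow> 'a measure" where
  "config_measure \<omega> = distr (count_space \<omega>) borel (\<lambda>x. x)"

definition vague_topology :: "'a::metric_space set topology" where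
  "vague_topology = topology_generated_by
     {{\<omega> \<in> configurations. (\<integral>x. f x \<partial>config_measure \<omega>) \<in> U} | f U.
        f \<in> compactly_supported_continuous \<and> open U}"

definition config_space :: "'a::metric_space set measure" where
  "config_space = sigma configurations {U. openin vague_topology U}"

text \<open>The equation below entails integrability of the exponential functional, because the
  Bochner integral of a non-integrable function is \<open>0\<close> and the right-hand side is
  positive.\<close>

definition poisson_measure :: "'a::metric_space measure \<Rightarrow> 'a set measure \<Rightarrow> bool" where
  "poisson_measure \<sigma> \<mu> \<longleftrightarrow>
     prob_space \<mu> \<and> sets \<mu> = sets config_space \<and>
     (\<forall>f\<in>compactly_supported_continuous.
        (\<integral>\<omega>. exp (\<integral>x. f x \<partial>config_measure \<omega>) \<partial>\<mu>) =
        exp (\<integral>x. (exp (f x) - 1) \<partial>\<sigma>))"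

definition total_variation_dist :: "'a::metric_space set \<Rightarrow> 'a set \<Rightarrow> ennreal" where
  "total_variation_dist \<omega> \<eta> =
     (\<Sum>\<^sub>\<infinity>x. ennreal \<bar>measure (config_measure \<omega>) {x} - measure (config_measure \<eta>) {x}\<bar>)"

definition couplings :: "'b measure \<Rightarrow> 'b measure \<Rightarrow> ('b \<times> 'b) measure set" where
  "couplings \<mu> \<nu> =
     {\<gamma>. prob_space \<gamma> \<and> sets \<gamma> = sets (\<mu> \<Otimes>\<^sub>M \<nu>) \<and>
         distr \<gamma> \<mu> fst = \<mu> \<and> distr \<gamma> \<nu> snd = \<nu>}"

text \<open>For a non-measurable cost the nonnegative integral is the lower integral. This does
  not happen for the total variation distance on a locally compact \<open>\<sigma>\<close>-compact metric
  space, where point counts in Borel sets are measurable.\<close>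

definition rubinstein_dist ::
  "('b \<Rightarrow> 'b \<Rightarrow> ennreal) \<Rightarrow> 'b measure \<Rightarrow> 'b measure \<Rightarrow> ennreal" where
  "rubinstein_dist \<rho> \<mu> \<nu> = (INF \<gamma>\<in>couplings \<mu> \<nu>. \<integral>\<^sup>+z. \<rho> (fst z) (snd z) \<partial>\<gamma>)"

end

theory Submission
  imports Defs
begin

text \<open>If \<open>\<sigma> \<noteq> 0\<close>, write \<open>\<sigma> = g Q\<close> with a probability measure \<open>Q\<close>, and consider a Poisson process of intensity
  \<open>Q \<otimes> Lebesgue\<close> on the space times \<open>[0, \<infinity>)\<close>. Its points below the graph of \<open>g\<close>, projected to the space,
  form a Poisson process of intensity \<open>g Q = \<sigma>\<close>, and its points below the graph of \<open>g p\<close> form one of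
  intensity \<open>g p Q = \<tau>\<close> (\<open>poisson_realisation\<close>). Taken together these two configurations are a coupling of
  the two Poisson measures. A point that belongs to only one of them comes from a point of the
  process between the two graphs (\<open>total_variation_projected_points_le\<close>), and the expected number
  of those is \<open>\<integral> |g - g p| dQ = \<integral> |p - 1| d\<sigma>\<close>, whence the bound.

  The Poisson measures are known only through their Laplace functionals, so the laws of the two
  configurations have to be identified by a uniqueness theorem (\<open>laplace_functional_unique\<close>). Its
  core is measure theoretic: the functions \<open>\<omega> \<mapsto> exp (\<integral> f d\<omega>)\<close> with \<open>f \<le> 0\<close> are \<open>[0,1]\<close>-valued and closed
  under multiplication, hence determine a probability measure on the \<open>\<sigma>\<close>-algebra that they
  generate (\<open>prob_measure_eqI_multiplicative\<close>). That this is the whole Borel \<open>\<sigma>\<close>-algebra of the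
  vague topology (\<open>sets_config_space_eq_laplace\<close>) is delicate, because a \<open>\<sigma>\<close>-compact metric space need
  not be locally compact and its vague topology need not be second countable. It does have a
  countable network, that is, countably many measurable sets of which every open set is a union.

  For the same reason it needs an argument that the projected points form a configuration: every
  point has a ball of finite \<open>\<sigma>\<close>-measure, so countably many open sets of finite measure absorb
  all compact sets (\<open>radon_measure_exhaustion\<close>). Finally \<open>\<sigma>\<close> and therefore \<open>Q\<close> have no atoms, so different
  points of the process have different projections, and sums over the process equal integrals
  against the configuration.\<close>

section \<open>Countable bases\<close>

text \<open>Each compact piece is totally bounded; the balls of radius \<open>1/m\<close> around the centres of finite
  nets of all pieces form a basis.\<close>
lemma sigma_compact_imp_countable_basis:
  assumes "sigma_compact_space TYPE('a::metric_space)"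
  obtains B :: "'a::metric_space set set" where "countable B" "topological_basis B"
proof -
  obtain K :: "nat \<Rightarrow> 'a set" where K: "\<And>n. compact (K n)" "(\<Union>n. K n) = UNIV"
    using assms unfolding sigma_compact_space_def by blast
  have "\<exists>D. finite D \<and> K n \<subseteq> (\<Union>x\<in>D. ball x (inverse (real (Suc m))))" for n m
    using seq_compact_imp_totally_bounded[OF compact_imp_seq_compact[OF K(1)[of n]]]
    by (meson inverse_positive_iff_positive of_nat_0_less_iff zero_less_Suc)
  then obtain D where D: "\<And>n m. finite (D n m)"
      "\<And>n m. K n \<subseteq> (\<Union>x\<in>D n m. ball x (inverse (real (Suc m))))"
    by metis
  define B where "B = (\<Union>m. \<Union>n. (\<lambda>x. ball x (inverse (real (Suc m)))) ` D n m)"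
  have "countable B"
    unfolding B_def by (intro countable_UN countable_image countable_finite[OF D(1)]) auto
  moreover have "topological_basis B"
  proof (subst topological_basis_iff)
    show "open b" if "b \<in> B" for b using that by (auto simp: B_def)
    show "\<forall>O'. open O' \<longrightarrow> (\<forall>x\<in>O'. \<exists>B'\<in>B. x \<in> B' \<and> B' \<subseteq> O')"
    proof (intro allI impI ballI)
      fix O' :: "'a set" and x assume "open O'" "x \<in> O'"
      then obtain e where e: "e > 0" "ball x e \<subseteq> O'" using open_contains_ball by blast
      obtain m where m: "inverse (real (Suc m)) < e / 2"
        using reals_Archimedean[of "e/2"] e(1) by auto
      obtain n where "x \<in> K n" using K(2) by blast
      then obtain d where d: "d \<in> D n m" "x \<in> ball d (inverse (real (Suc m)))" using D(2) by blast
      have "ball d (inverse (real (Suc m))) \<subseteq> ball x e"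
      proof
        fix y assume "y \<in> ball d (inverse (real (Suc m)))"
        then have "dist x y < e"
          using d(2) m dist_triangle[of x y d] by (simp add: dist_commute)
        then show "y \<in> ball x e" by simp
      qed
      then show "\<exists>B'\<in>B. x \<in> B' \<and> B' \<subseteq> O'"
        using d e(2) unfolding B_def by blast
    qed
  qed
  ultimately show ?thesis using that by blast
qed

section \<open>Integrals against configurations\<close>

abbreviation config_int :: "('a::metric_space \<Rightarrow> real) \<Rightarrow> 'a set \<Rightarrow> real" where
  "config_int f \<omega> \<equiv> \<integral>x. f x \<partial>config_measure \<omega>"

lemma compactly_supported_continuousI:
  fixes f :: "'a::metric_space \<Rightarrow> real"
  assumes "continuous_on UNIV f" "compact K" "\<And>x. f x \<noteq> 0 \<Longrightarrow> x \<in> K"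
  shows "f \<in> compactly_supported_continuous"
proof -
  have "closure (support_on UNIV f) \<subseteq> K"
    using assms by (intro closure_minimal compact_imp_closed) (auto simp: support_on_def)
  then have "compact (closure (support_on UNIV f))"
    using assms(2) by (metis closed_closure compact_Int_closed inf.absorb2)
  then show ?thesis using assms(1) by (simp add: compactly_supported_continuous_def)
qed

lemma compactly_supported_continuousE:
  fixes f :: "'a::metric_space \<Rightarrow> real"
  assumes "f \<in> compactly_supported_continuous"
  obtains K where "continuous_on UNIV f" "compact K" "{x. f x \<noteq> 0} \<subseteq> K"
  using assms closure_subset[of "support_on UNIV f"]
  by (auto simp: compactly_supported_continuous_def support_on_def)

lemma compactly_supported_continuous_measurable:
  assumes "f \<in> compactly_supported_continuous" shows "f \<in> borel_measurable borel"
  using assms by (auto simp: compactly_supported_continuous_def intro: borel_measurable_continuous_onI)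

lemma compactly_supported_continuous_scale_add:
  assumes "f \<in> compactly_supported_continuous" "g \<in> compactly_supported_continuous"
  shows "(\<lambda>x. a * f x + g x) \<in> compactly_supported_continuous"
proof -
  obtain K where K: "continuous_on UNIV f" "compact K" "{x. f x \<noteq> 0} \<subseteq> K"
    using assms(1) by (rule compactly_supported_continuousE)
  obtain L where L: "continuous_on UNIV g" "compact L" "{x. g x \<noteq> 0} \<subseteq> L"
    using assms(2) by (rule compactly_supported_continuousE)
  show ?thesis
  proof (rule compactly_supported_continuousI[where K = "K \<union> L"])
    show "x \<in> K \<union> L" if "a * f x + g x \<noteq> 0" for x
      using that K(3) L(3) by (cases "f x = 0") auto
  qed (use K L in \<open>auto intro!: continuous_intros\<close>)
qed

lemma zero_compactly_supported_continuous: "(\<lambda>x. 0) \<in> compactly_supported_continuous"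
  by (rule compactly_supported_continuousI[of _ "{}"]) auto

lemma configuration_support_finite:
  assumes "\<omega> \<in> configurations" "f \<in> compactly_supported_continuous"
  shows "finite {x\<in>\<omega>. f x \<noteq> 0}"
proof -
  obtain K where K: "continuous_on UNIV f" "compact K" "{x. f x \<noteq> 0} \<subseteq> K"
    using assms(2) by (rule compactly_supported_continuousE)
  have "finite (\<omega> \<inter> K)" using assms(1) K(2) by (auto simp: configurations_def)
  then show ?thesis by (rule rev_finite_subset) (use K(3) in auto)
qed

text \<open>The set \<open>F\<close> may contain zeros of \<open>f\<close>, so that one \<open>F\<close> can serve several functions.\<close>
lemma config_int_eq_sum:
  assumes "f \<in> borel_measurable borel" "finite F" "F \<subseteq> \<omega>" "\<And>x. x \<in> \<omega> \<Longrightarrow> f x \<noteq> 0 \<Longrightarrow> x \<in> F"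
  shows "config_int f \<omega> = (\<Sum>x\<in>F. f x)"
proof -
  have eq: "{x \<in> F. f x \<noteq> 0} = {x. x \<in> \<omega> \<and> f x \<noteq> 0}" using assms(3,4) by blast
  have "finite {x. x \<in> \<omega> \<and> f x \<noteq> 0}" using assms(2) by (auto simp: eq[symmetric])
  then have "config_int f \<omega> = (\<Sum>x | x \<in> \<omega> \<and> f x \<noteq> 0. f x)"
    unfolding config_measure_def using assms(1)
    by (subst integral_distr) (auto simp: lebesgue_integral_count_space_finite_support)
  also have "\<dots> = (\<Sum>x\<in>F. f x)"
    unfolding eq[symmetric] by (rule sum.mono_neutral_left) (use assms(2) in auto)
  finally show ?thesis .
qed

lemma config_int_scale_add:
  assumes \<omega>: "\<omega> \<in> configurations"
    and f: "f \<in> compactly_supported_continuous" and g: "g \<in> compactly_supported_continuous"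
  shows "config_int (\<lambda>x. a * f x + g x) \<omega> = a * config_int f \<omega> + config_int g \<omega>"
proof -
  let ?F = "{x\<in>\<omega>. f x \<noteq> 0} \<union> {x\<in>\<omega>. g x \<noteq> 0}"
  have F: "finite ?F" using configuration_support_finite[OF \<omega>] f g by blast
  note [measurable] = compactly_supported_continuous_measurable[OF f]
    compactly_supported_continuous_measurable[OF g]
  have "config_int (\<lambda>x. a * f x + g x) \<omega> = (\<Sum>x\<in>?F. a * f x + g x)"
    by (rule config_int_eq_sum) (use F in auto)
  moreover have "config_int f \<omega> = (\<Sum>x\<in>?F. f x)" "config_int g \<omega> = (\<Sum>x\<in>?F. g x)"
    by (rule config_int_eq_sum; use F in auto)+
  ultimately show ?thesis by (simp add: sum.distrib sum_distrib_left)
qed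

lemma measure_config_measure_singleton:
  "measure (config_measure \<omega>) {x} = indicator \<omega> x"
  unfolding config_measure_def
  by (subst measure_distr) (auto simp: measure_def emeasure_count_space_finite indicator_def)

text \<open>An open set of a cover that contains the limit point contains all but finitely many of the
  compact sets.\<close>
lemma compact_insert_shrinking_compacts:
  fixes x :: "'a::metric_space"
  assumes "\<And>n::nat. compact (K n)" "\<And>n. K n \<subseteq> ball x (inverse (real (Suc n)))"
  shows "compact (insert x (\<Union>n. K n))"
  unfolding compact_eq_Heine_Borel
proof (intro allI impI, elim conjE)
  fix \<C> :: "'a set set"
  assume op: "\<forall>t\<in>\<C>. open t" and cov: "insert x (\<Union>n. K n) \<subseteq> \<Union>\<C>"
  then obtain c where c: "c \<in> \<C>" "x \<in> c" by blast
  then obtain e where e: "e > 0" "ball x e \<subseteq> c" using op open_contains_ball by blast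
  obtain N where N: "inverse (real (Suc N)) < e" using reals_Archimedean[OF e(1)] by auto
  have tail: "K n \<subseteq> c" if "N \<le> n" for n
  proof -
    have "inverse (real (Suc n)) \<le> inverse (real (Suc N))"
      using that by (intro le_imp_inverse_le) auto
    then have "ball x (inverse (real (Suc n))) \<subseteq> ball x e" using N by (intro subset_ball) linarith
    then show ?thesis using assms(2)[of n] e(2) by blast
  qed
  have head: "compact (\<Union>n\<in>{..<N}. K n)" using assms(1) by (intro compact_UN) auto
  have "(\<Union>n\<in>{..<N}. K n) \<subseteq> \<Union>\<C>" using cov by blast
  then obtain D where D: "D \<subseteq> \<C>" "finite D" "(\<Union>n\<in>{..<N}. K n) \<subseteq> \<Union>D"
    using op compactE[OF head] by metis
  have "insert x (\<Union>n. K n) \<subseteq> \<Union>(insert c D)"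
  proof
    fix y assume "y \<in> insert x (\<Union>n. K n)"
    then consider "y = x" | n where "y \<in> K n" by blast
    then show "y \<in> \<Union>(insert c D)"
    proof cases
      case (2 n)
      then show ?thesis using tail[of n] D(3) by (cases "n < N") (auto simp: not_less)
    qed (use c in auto)
  qed
  then show "\<exists>C'\<subseteq>\<C>. finite C' \<and> insert x (\<Union>n. K n) \<subseteq> \<Union>C'"
    using D c by (intro exI[of _ "insert c D"]) auto
qed

text \<open>Compact sets include convergent sequences together with their limit, so a configuration
  has no accumulation point in the whole space, even where the space is not locally compact.\<close>
lemma configuration_not_islimpt:
  fixes x :: "'a::metric_space"
  assumes "\<omega> \<in> configurations" shows "\<not> x islimpt \<omega>"
proof
  assume lim: "x islimpt \<omega>"
  have "\<exists>y\<in>\<omega>. y \<noteq> x \<and> dist y x < inverse (real (Suc n))" for n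
    using lim unfolding islimpt_approachable
    by (metis inverse_positive_iff_positive of_nat_0_less_iff zero_less_Suc)
  then obtain f where f: "\<And>n. f n \<in> \<omega>" "\<And>n. f n \<noteq> x" "\<And>n. dist (f n) x < inverse (real (Suc n))"
    by metis
  have "compact (insert x (\<Union>n. {f n}))"
    by (rule compact_insert_shrinking_compacts) (use f(3) in \<open>auto simp: dist_commute\<close>)
  then have "finite (\<omega> \<inter> insert x (\<Union>n. {f n}))" using assms by (auto simp: configurations_def)
  then have "finite (range f)" by (rule rev_finite_subset) (use f(1) in auto)
  then have "closed (range f)" by (rule finite_imp_closed)
  moreover have "f \<longlonglongrightarrow> x"
  proof (rule metric_LIMSEQ_I)
    fix r :: real assume "r > 0"
    then obtain N where N: "inverse (real (Suc N)) < r" using reals_Archimedean by blast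
    have "dist (f n) x < r" if "N \<le> n" for n
    proof -
      have "inverse (real (Suc n)) \<le> inverse (real (Suc N))"
        using that by (intro le_imp_inverse_le) auto
      then show ?thesis using f(3)[of n] N by linarith
    qed
    then show "\<exists>no. \<forall>n\<ge>no. dist (f n) x < r" by blast
  qed
  ultimately have "x \<in> range f" using closed_sequentially[of "range f" f x] by blast
  then show False using f(2) by auto
qed

text \<open>Restricting to \<open>f \<le> 0\<close> keeps the exponentials \<open>exp (config_int f \<omega>)\<close> in \<open>[0,1]\<close>, as the uniqueness
  of Laplace functionals requires; a general \<open>f\<close> is a difference of two such functions.\<close>
definition laplace_sets :: "'a::metric_space set set set" where
  "laplace_sets = {{\<omega>\<in>configurations. c < config_int f \<omega>} | f c.
     f \<in> compactly_supported_continuous \<and> (\<forall>x. f x \<le> 0)}"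

lemma laplace_sets_Pow: "laplace_sets \<subseteq> Pow configurations"
  by (auto simp: laplace_sets_def)

lemma config_int_measurable_laplace:
  assumes "f \<in> compactly_supported_continuous" "\<And>x. 0 \<le> f x"
  shows "config_int f \<in> borel_measurable (sigma configurations laplace_sets)"
proof -
  have "(\<lambda>x. - f x) \<in> compactly_supported_continuous"
    using compactly_supported_continuous_scale_add[OF assms(1) zero_compactly_supported_continuous, of "-1"]
    by simp
  then have "{\<omega>\<in>configurations. c < config_int (\<lambda>x. - f x) \<omega>} \<in> laplace_sets" for c
    using assms(2) unfolding laplace_sets_def by (intro CollectI exI[of _ "\<lambda>x. - f x"] exI[of _ c]) auto
  then have "config_int (\<lambda>x. - f x) \<in> borel_measurable (sigma configurations laplace_sets)"
    unfolding borel_measurable_iff_greater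
    by (simp only: sets_measure_of[OF laplace_sets_Pow] space_measure_of[OF laplace_sets_Pow]) blast
  then have "(\<lambda>\<omega>. - config_int (\<lambda>x. - f x) \<omega>) \<in> borel_measurable (sigma configurations laplace_sets)"
    by measurable
  then show ?thesis by simp
qed

text \<open>The indicator of a relatively compact open set is an increasing limit of continuous functions
  supported in its closure.\<close>
lemma card_open_measurable_laplace:
  fixes C :: "'a::metric_space set"
  assumes "open C" "compact (closure C)"
  shows "(\<lambda>\<omega>. real (card (\<omega> \<inter> C))) \<in> borel_measurable (sigma configurations laplace_sets)"
proof -
  \<comment> \<open>\<open>infdist\<close> to the empty set is 0, hence the case distinction\<close>
  define g where "g n x = (if C = UNIV then 1 else min 1 (real n * infdist x (- C)))" for n x
  have g0: "g n x = 0" if "x \<notin> C" for n x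
    using that by (auto simp: g_def)
  have cc: "g n \<in> compactly_supported_continuous" for n
  proof (rule compactly_supported_continuousI[OF _ assms(2)])
    show "continuous_on UNIV (g n)"
      unfolding g_def by (cases "C = UNIV") (auto intro!: continuous_intros)
    show "x \<in> closure C" if "g n x \<noteq> 0" for x
      using that g0 closure_subset[of C] by blast
  qed
  have nn: "0 \<le> g n x" for n x by (auto simp: g_def infdist_nonneg)
  have lim: "(\<lambda>n. g n x) \<longlonglongrightarrow> 1" if "x \<in> C" for x
  proof (cases "C = UNIV")
    case False
    have "0 < infdist x (- C)"
      using that False assms(1) infdist_pos_not_in_closed[of "-C" x] by auto
    then have "eventually (\<lambda>n. 1 \<le> real n * infdist x (- C)) sequentially"
      using filterlim_at_top_mult_tendsto_pos[OF tendsto_const _ filterlim_real_sequentially, of "infdist x (- C)"]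
      by (auto simp: filterlim_at_top)
    then show ?thesis
      by (intro tendsto_eventually) (auto elim!: eventually_mono simp: g_def False)
  qed (simp add: g_def)
  show ?thesis
  proof (rule borel_measurable_LIMSEQ_real)
    show "config_int (g n) \<in> borel_measurable (sigma configurations laplace_sets)" for n
      by (rule config_int_measurable_laplace[OF cc nn])
    fix \<omega> :: "'a set" assume "\<omega> \<in> space (sigma configurations laplace_sets)"
    then have "\<omega> \<in> configurations" using laplace_sets_Pow by (auto simp: space_measure_of_conv)
    then have "finite (\<omega> \<inter> closure C)" using assms(2) by (auto simp: configurations_def)
    then have fin: "finite (\<omega> \<inter> C)" by (rule rev_finite_subset) (use closure_subset[of C] in auto)
    have "config_int (g n) \<omega> = (\<Sum>x\<in>\<omega> \<inter> C. g n x)" for n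
      by (rule config_int_eq_sum[OF compactly_supported_continuous_measurable[OF cc] fin])
         (use g0[of _ n] in auto)
    moreover have "(\<lambda>n. \<Sum>x\<in>\<omega> \<inter> C. g n x) \<longlonglongrightarrow> (\<Sum>x\<in>\<omega> \<inter> C. 1)"
      by (intro tendsto_sum lim) auto
    ultimately show "(\<lambda>n. config_int (g n) \<omega>) \<longlonglongrightarrow> real (card (\<omega> \<inter> C))" by simp
  qed
qed


section \<open>Borel sets of the vague topology\<close>

text \<open>The vague topology need not be second countable when the space is not locally compact, but
  it has a countable network, which consists of the following sets for finite \<open>S\<close> and \<open>T\<close>. Here \<open>R\<close>
  is the family of relatively compact members of a countable basis, so \<open>\<Union>R\<close> is the set of points
  with a compact neighbourhood. Points outside \<open>\<Union>R\<close> are ignored: every compactly supported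
  continuous function vanishes there, and counts of such points need not be measurable.\<close>
definition network_set :: "'a::metric_space set set \<Rightarrow> 'a set set \<Rightarrow> 'a set set \<Rightarrow> 'a set set" where
  "network_set R S T = {\<omega>\<in>configurations.
     (\<forall>C\<in>S. card (\<omega> \<inter> C) = 1) \<and> (\<forall>B\<in>T. \<omega> \<inter> B \<inter> \<Union>R = {})}"

text \<open>Sets of \<open>T\<close> need not be relatively compact, but inside \<open>\<Union>R\<close> they are countable unions of
  relatively compact open sets, whose counts are measurable.\<close>
lemma network_set_measurable_laplace:
  fixes R :: "'a::metric_space set set"
  assumes R: "countable R" "\<And>C. C \<in> R \<Longrightarrow> open C \<and> compact (closure C)"
    and S: "finite S" "S \<subseteq> R" and T: "finite T" "\<And>B. B \<in> T \<Longrightarrow> open B"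
  shows "network_set R S T \<in> sets (sigma configurations laplace_sets)"
proof -
  let ?M = "sigma configurations (laplace_sets :: 'a set set set)"
  have sp: "space ?M = configurations" by (rule space_measure_of[OF laplace_sets_Pow])
  have card_set: "{\<omega>\<in>configurations. card (\<omega> \<inter> C) = k} \<in> sets ?M"
    if "open C" "compact (closure C)" for C k
  proof -
    note [measurable] = card_open_measurable_laplace[OF that]
    have "{\<omega>\<in>space ?M. real (card (\<omega> \<inter> C)) = real k} \<in> sets ?M" by measurable
    then show ?thesis by (simp add: sp)
  qed
  have rc: "open (C \<inter> B)" "compact (closure (C \<inter> B))" if "C \<in> R" "open B" for C B
    using R(2)[OF that(1)] that(2) closure_mono[of "C \<inter> B" C]
    by (auto simp: open_Int) (metis closed_closure compact_Int_closed inf.absorb2)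
  have empty_eq: "{\<omega>\<in>configurations. \<omega> \<inter> B \<inter> \<Union>R = {}}
      = configurations \<inter> (\<Inter>C\<in>R. {\<omega>\<in>configurations. card (\<omega> \<inter> (C \<inter> B)) = 0})" if "open B" for B
  proof -
    have "finite (\<omega> \<inter> (C \<inter> B))" if \<omega>: "\<omega> \<in> configurations" and C: "C \<in> R" for \<omega> C
    proof -
      have "finite (\<omega> \<inter> closure C)" using \<omega> R(2)[OF C] by (auto simp: configurations_def)
      then show ?thesis by (rule rev_finite_subset) (use closure_subset[of C] in auto)
    qed
    then show ?thesis by (auto simp: card_eq_0_iff)
  qed
  have empty_set: "{\<omega>\<in>configurations. \<omega> \<inter> B \<inter> \<Union>R = {}} \<in> sets ?M" if "open B" for B
  proof (cases "R = {}")
    case True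
    then show ?thesis using sets.top[of ?M] by (simp add: sp)
  next
    case False
    then show ?thesis unfolding empty_eq[OF that]
      by (intro sets.Int sets.countable_INT') (use sets.top[of ?M] card_set rc R(1) that in \<open>auto simp: sp\<close>)
  qed
  have "network_set R S T = configurations \<inter> (\<Inter>C\<in>S. {\<omega>\<in>configurations. card (\<omega> \<inter> C) = 1})
     \<inter> (\<Inter>B\<in>T. {\<omega>\<in>configurations. \<omega> \<inter> B \<inter> \<Union>R = {}})"
    by (auto simp: network_set_def)
  moreover have "configurations \<inter> (\<Inter>C\<in>S. {\<omega>\<in>configurations. card (\<omega> \<inter> C) = 1}) \<in> sets ?M"
  proof (cases "S = {}")
    case False
    then show ?thesis
      by (intro sets.Int sets.finite_INT) (use S R(2) card_set sets.top[of ?M] in \<open>auto simp: sp\<close>)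
  qed (use sets.top[of ?M] in \<open>simp add: sp\<close>)
  ultimately show ?thesis
  proof (cases "T = {}")
    case False
    show ?thesis unfolding \<open>network_set R S T = _\<close>
      by (rule sets.Int[OF _ sets.finite_INT])
         (use \<open>configurations \<inter> (\<Inter>C\<in>S. _ C) \<in> _\<close> False T empty_set in auto)
  qed simp
qed


text \<open>Around the finitely many points of \<open>\<omega>\<close> that \<open>f\<close> can see, take small disjoint sets \<open>C x\<close> on which
  \<open>f\<close> varies by less than \<open>\<delta>\<close>, and cover the rest of a compact set supporting \<open>f\<close> by finitely many
  basic sets that miss all other visible points of \<open>\<omega>\<close>. A configuration with one point in each
  \<open>C x\<close> and none in the remaining cover has nearly the same integral of \<open>f\<close>.\<close>
lemma network_set_neighbourhood:
  fixes \<omega> :: "'a::metric_space set"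
  assumes B: "topological_basis B" and R: "R = {C\<in>B. compact (closure C)}"
    and \<omega>: "\<omega> \<in> configurations" and f: "f \<in> compactly_supported_continuous"
    and W: "open W" "config_int f \<omega> \<in> W"
  shows "\<exists>S T. finite S \<and> S \<subseteq> R \<and> finite T \<and> T \<subseteq> B \<and> \<omega> \<in> network_set R S T \<and>
    network_set R S T \<subseteq> {\<eta>\<in>configurations. config_int f \<eta> \<in> W}"
proof -
  note fm = compactly_supported_continuous_measurable[OF f]
  obtain K where K: "continuous_on UNIV f" "compact K" "{x. f x \<noteq> 0} \<subseteq> K"
    using f by (rule compactly_supported_continuousE)
  obtain e where e: "e > 0" "\<And>y. dist y (config_int f \<omega>) < e \<Longrightarrow> y \<in> W"
    using W unfolding open_dist by blast
  define G where "G = \<omega> \<inter> K \<inter> \<Union>R"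
  have finG: "finite G" using \<omega> K(2) by (auto simp: G_def configurations_def)
  define \<delta> where "\<delta> = e / real (card G + 1)"
  have \<delta>: "\<delta> > 0" using e(1) by (simp add: \<delta>_def)
  \<comment> \<open>open subsets of a compact set contain members of \<open>R\<close> around each point\<close>
  have basis_R: "\<exists>b\<in>R. x \<in> b \<and> b \<subseteq> V" if "open V" "x \<in> V" "V \<subseteq> L" "compact L" for x V L
  proof -
    obtain b where b: "b \<in> B" "x \<in> b" "b \<subseteq> V" using B \<open>open V\<close> \<open>x \<in> V\<close> by (rule topological_basisE)
    have "closure b \<subseteq> L" using b(3) that(3,4) by (intro closure_minimal compact_imp_closed) auto
    then have "compact (closure b)" using \<open>compact L\<close> by (metis closed_closure compact_Int_closed inf.absorb2)
    then show ?thesis using b R by auto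
  qed
  have nz: "x \<in> \<Union>R" if "f x \<noteq> 0" for x
  proof -
    have "open {x. f x \<noteq> 0}" by (rule open_Collect_neq[OF K(1)]) auto
    then show ?thesis using basis_R[of "{x. f x \<noteq> 0}" x K] K(2,3) that by blast
  qed
  have "\<exists>r>0. \<forall>z\<in>\<omega>. z \<noteq> y \<longrightarrow> r \<le> dist z y" for y
    using configuration_not_islimpt[OF \<omega>, of y] unfolding islimpt_approachable by (auto simp: not_less)
  then obtain r where r: "\<And>y. r y > 0" "\<And>y z. z \<in> \<omega> \<Longrightarrow> z \<noteq> y \<Longrightarrow> r y \<le> dist z y"
    by metis
  have "\<exists>C\<in>R. x \<in> C \<and> C \<subseteq> ball x (r x / 2) \<and> (\<forall>y\<in>C. \<bar>f y - f x\<bar> < \<delta>)" if x: "x \<in> G" for x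
  proof -
    obtain C0 where C0: "C0 \<in> R" "x \<in> C0" using x unfolding G_def by blast
    then have oC0: "open C0" "compact (closure C0)" using B R topological_basis_open by auto
    have o: "open {y. \<bar>f y - f x\<bar> < \<delta>}" using K(1) by (intro open_Collect_less continuous_intros)
    have "\<exists>b\<in>R. x \<in> b \<and> b \<subseteq> ball x (r x / 2) \<inter> {y. \<bar>f y - f x\<bar> < \<delta>} \<inter> C0"
      by (rule basis_R[of _ _ "closure C0"])
         (use o oC0 C0(2) \<delta> r(1)[of x] closure_subset[of C0] in \<open>auto intro!: open_Int\<close>)
    then show ?thesis by blast
  qed
  then obtain C where C: "\<And>x. x \<in> G \<Longrightarrow> C x \<in> R" "\<And>x. x \<in> G \<Longrightarrow> x \<in> C x"
      "\<And>x. x \<in> G \<Longrightarrow> C x \<subseteq> ball x (r x / 2)" "\<And>x y. x \<in> G \<Longrightarrow> y \<in> C x \<Longrightarrow> \<bar>f y - f x\<bar> < \<delta>"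
    by metis
  have disj: "C x \<inter> C y = {}" if "x \<in> G" "y \<in> G" "x \<noteq> y" for x y
  proof -
    have "r x \<le> dist x y" "r y \<le> dist x y"
      using that r(2)[of x y] r(2)[of y x] by (auto simp: G_def dist_commute)
    moreover have "dist x y < r x / 2 + r y / 2" if "z \<in> C x" "z \<in> C y" for z
      using C(3)[OF \<open>x \<in> G\<close>] C(3)[OF \<open>y \<in> G\<close>] that dist_triangle2[of x y z]
      by (fastforce simp: dist_commute)
    ultimately show ?thesis by fastforce
  qed
  have C\<omega>: "\<omega> \<inter> C x = {x}" if "x \<in> G" for x
  proof -
    have "z = x" if "z \<in> \<omega>" "z \<in> C x" for z
    proof (rule ccontr)
      assume "z \<noteq> x"
      then have "r x \<le> dist z x" using r(2) that by auto
      moreover have "dist z x < r x / 2" using C(3)[OF \<open>x \<in> G\<close>] that(2) by (auto simp: dist_commute)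
      ultimately show False using r(1)[of x] by linarith
    qed
    then show ?thesis using C(2)[OF that] that by (auto simp: G_def)
  qed
  have "\<exists>D\<in>B. y \<in> D \<and> (if y \<in> G then D = C y else \<omega> \<inter> D \<subseteq> {y})" for y
  proof (cases "y \<in> G")
    case True
    then show ?thesis using C(1,2) R by auto
  next
    case False
    obtain b where b: "b \<in> B" "y \<in> b" "b \<subseteq> ball y (r y)"
      by (rule topological_basisE[OF B open_ball[of y "r y"]]) (use r(1)[of y] in auto)
    have "z = y" if "z \<in> \<omega>" "z \<in> b" for z
      using r(2)[OF that(1), of y] b(3) that(2) by (force simp: dist_commute)
    then show ?thesis using b False by auto
  qed
  then obtain D where D: "\<And>y. D y \<in> B" "\<And>y. y \<in> D y" "\<And>y. y \<in> G \<Longrightarrow> D y = C y"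
      "\<And>y. y \<notin> G \<Longrightarrow> \<omega> \<inter> D y \<subseteq> {y}"
    by metis
  obtain Y where Y: "Y \<subseteq> K" "finite Y" "K \<subseteq> (\<Union>y\<in>Y. D y)"
    by (rule compactE_image[OF K(2), of K D])
       (use D(1,2) topological_basis_open[OF B] in auto)
  let ?S = "C ` G" and ?T = "D ` (Y - G)"
  have "\<omega> \<inter> D y \<inter> \<Union>R = {}" if "y \<in> Y - G" for y
    using D(4)[of y] that Y(1) by (auto simp: G_def)
  then have "\<omega> \<in> network_set R ?S ?T"
    using \<omega> C\<omega> by (auto simp: network_set_def)
  moreover have "config_int f \<eta> \<in> W" if \<eta>: "\<eta> \<in> network_set R ?S ?T" for \<eta>
  proof -
    have "\<exists>c. \<eta> \<inter> C x = {c}" if "x \<in> G" for x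
      using \<eta> that by (auto simp: network_set_def card_1_singleton_iff)
    then obtain c where c: "\<And>x. x \<in> G \<Longrightarrow> \<eta> \<inter> C x = {c x}" by metis
    then have cC: "c x \<in> C x" "c x \<in> \<eta>" if "x \<in> G" for x using that by auto
    have inj: "inj_on c G" by (rule inj_onI) (metis cC(1) disj disjoint_iff)
    have "z \<in> c ` G" if z: "z \<in> \<eta>" "f z \<noteq> 0" for z
    proof -
      obtain y where y: "y \<in> Y" "z \<in> D y" using z(2) K(3) Y(3) by blast
      have "y \<in> G"
        using \<eta> y z(1) nz[OF z(2)] by (auto simp: network_set_def)
      then show ?thesis using c[of y] D(3)[of y] y(2) z(1) by auto
    qed
    then have "config_int f \<eta> = (\<Sum>z\<in>c ` G. f z)"
      by (intro config_int_eq_sum fm) (use finG cC in auto)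
    also have "\<dots> = (\<Sum>x\<in>G. f (c x))" by (simp add: sum.reindex[OF inj])
    finally have "dist (config_int f \<eta>) (config_int f \<omega>) = \<bar>\<Sum>x\<in>G. f (c x) - f x\<bar>"
      by (subst (2) config_int_eq_sum[OF fm finG])
         (use nz K(3) in \<open>auto simp: G_def dist_real_def sum_subtractf\<close>)
    also have "\<dots> \<le> (\<Sum>x\<in>G. \<bar>f (c x) - f x\<bar>)" by (rule sum_abs)
    also have "\<dots> \<le> (\<Sum>x\<in>G. \<delta>)" by (intro sum_mono less_imp_le C(4) cC(1))
    also have "\<dots> < e" using e(1) by (simp add: \<delta>_def field_simps)
    finally show ?thesis by (rule e(2))
  qed
  ultimately show ?thesis
    by (intro exI[of _ ?S] exI[of _ ?T])
       (use finG Y(2) C(1) D(1) in \<open>auto simp: network_set_def\<close>)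
qed

lemma network_set_Un:
  "network_set R (S \<union> S') (T \<union> T') = network_set R S T \<inter> network_set R S' T'"
  unfolding network_set_def ball_Un Int_def[of "Collect _" "Collect _"] mem_Collect_eq by (rule Collect_cong) iprover

lemma vague_open_contains_network_set:
  fixes \<omega> :: "'a::metric_space set"
  assumes B: "topological_basis B" and R: "R = {C\<in>B. compact (closure C)}"
    and V: "openin vague_topology V" "\<omega> \<in> V"
  shows "\<exists>S T. finite S \<and> S \<subseteq> R \<and> finite T \<and> T \<subseteq> B \<and> \<omega> \<in> network_set R S T \<and>
    network_set R S T \<subseteq> V"
proof -
  from V(1) have "generate_topology_on {{\<omega> \<in> configurations. config_int f \<omega> \<in> U} | f U.
        f \<in> compactly_supported_continuous \<and> open U} V"
    unfolding vague_topology_def openin_topology_generated_by_iff .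
  then show ?thesis using V(2)
  proof (induction V)
    case (Int V1 V2)
    obtain S1 T1 where 1: "finite S1" "S1 \<subseteq> R" "finite T1" "T1 \<subseteq> B" "\<omega> \<in> network_set R S1 T1"
      "network_set R S1 T1 \<subseteq> V1" using Int by blast
    obtain S2 T2 where 2: "finite S2" "S2 \<subseteq> R" "finite T2" "T2 \<subseteq> B" "\<omega> \<in> network_set R S2 T2"
      "network_set R S2 T2 \<subseteq> V2" using Int by blast
    show ?case
      by (rule exI[of _ "S1 \<union> S2"], rule exI[of _ "T1 \<union> T2"])
         (use 1 2 in \<open>auto simp: network_set_Un\<close>)
  next
    case (UN \<V>)
    then obtain V where "V \<in> \<V>" "\<omega> \<in> V" by blast
    then show ?case using UN(2)[of V] by blast
  next
    case (Basis V)
    then obtain f U where V: "V = {\<omega> \<in> configurations. config_int f \<omega> \<in> U}"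
      "f \<in> compactly_supported_continuous" "open U" by blast
    then show ?case
      using network_set_neighbourhood[OF B R _ V(2,3)] Basis(2) by auto
  qed simp
qed

lemma vague_open_subset: "openin vague_topology V \<Longrightarrow> V \<subseteq> configurations"
  using openin_subset[of vague_topology V] by (auto simp: vague_topology_def)

lemma space_config_space: "space config_space = configurations"
  unfolding config_space_def by (rule space_measure_of) (use vague_open_subset in auto)

lemma config_int_measurable:
  assumes "f \<in> compactly_supported_continuous"
  shows "config_int f \<in> borel_measurable config_space"
proof (rule borel_measurableI)
  fix U :: "real set" assume "open U"
  then have "openin vague_topology {\<omega>\<in>configurations. config_int f \<omega> \<in> U}"
    unfolding vague_topology_def using assms by (intro topology_generated_by_Basis) blast
  moreover have "{V. openin vague_topology V} \<subseteq> Pow configurations" using vague_open_subset by auto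
  ultimately show "config_int f -` U \<inter> space config_space \<in> sets config_space"
    unfolding space_config_space unfolding config_space_def
    by (auto simp: sets_measure_of vimage_def Int_def conj_commute intro!: sigma_sets.Basic)
qed

text \<open>Every vaguely open set is a union of members of a countable network of measurable sets, so
  the Borel sets of the vague topology are determined by the linear functionals alone.\<close>
theorem sets_config_space_eq_laplace:
  assumes "sigma_compact_space TYPE('a::metric_space)"
  shows "sets (config_space :: 'a set measure) = sigma_sets configurations laplace_sets"
proof (rule antisym)
  obtain B :: "'a set set" where B: "countable B" "topological_basis B"
    using sigma_compact_imp_countable_basis[OF assms] .
  define R where "R = {C\<in>B. compact (closure C)}"
  let ?M = "sigma configurations (laplace_sets :: 'a set set set)"
  have sub: "{V. openin vague_topology V} \<subseteq> Pow (configurations :: 'a set set)"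
    using vague_open_subset by auto
  have "V \<in> sets ?M" if V: "openin vague_topology V" for V :: "'a set set"
  proof -
    define I where "I = {(S, T). finite S \<and> S \<subseteq> R \<and> finite T \<and> T \<subseteq> B \<and> network_set R S T \<subseteq> V}"
    have "countable R" using B(1) by (auto simp: R_def)
    then have "countable ({S. finite S \<and> S \<subseteq> R} \<times> {T. finite T \<and> T \<subseteq> B})"
      using B(1) by (intro countable_SIGMA countable_Collect_finite_subset) auto
    then have "countable I" by (rule countable_subset[rotated]) (auto simp: I_def)
    moreover have "network_set R S T \<in> sets ?M" if "(S, T) \<in> I" for S T
      using that \<open>countable R\<close> topological_basis_open[OF B(2)]
      by (intro network_set_measurable_laplace) (auto simp: I_def R_def)
    ultimately have "(\<Union>(S, T)\<in>I. network_set R S T) \<in> sets ?M"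
      by (intro sets.countable_UN') auto
    also have "(\<Union>(S, T)\<in>I. network_set R S T) = V"
      using vague_open_contains_network_set[OF B(2) R_def V] by (fastforce simp: I_def)
    finally show ?thesis .
  qed
  then show "sets (config_space :: 'a set measure) \<subseteq> sigma_sets configurations laplace_sets"
    unfolding config_space_def sets_measure_of[OF sub] sets_measure_of[OF laplace_sets_Pow]
    by (intro sigma_sets_mono) auto
  have "{\<omega>\<in>space config_space. c < config_int f \<omega>} \<in> sets config_space"
    if "f \<in> compactly_supported_continuous" for f :: "'a \<Rightarrow> real" and c
    using config_int_measurable[OF that] by measurable
  then have "laplace_sets \<subseteq> sets (config_space :: 'a set measure)"
    by (auto simp: laplace_sets_def space_config_space)
  then show "sigma_sets configurations laplace_sets \<subseteq> sets (config_space :: 'a set measure)"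
    using sets.sigma_sets_subset[of laplace_sets config_space] by (simp add: space_config_space)
qed

section \<open>Uniqueness of the Laplace functional\<close>

text \<open>Weierstrass approximation of steeper and steeper ramps. It turns agreement on the powers of a
  \<open>[0,1]\<close>-valued function into agreement on the indicators of its superlevel sets.\<close>
lemma polynomials_tendsto_indicator:
  fixes c :: real
  obtains q :: "nat \<Rightarrow> real \<Rightarrow> real"
    where "\<And>k. real_polynomial_function (q k)"
      "\<And>k y. y \<in> {0..1} \<Longrightarrow> \<bar>q k y\<bar> \<le> 2"
      "\<And>y. y \<in> {0..1} \<Longrightarrow> (\<lambda>k. q k y) \<longlonglongrightarrow> indicator {c<..} y"
proof -
  define g where "g k y = min 1 (real k * max 0 (y - c))" for k y
  have "\<exists>q. real_polynomial_function q \<and> (\<forall>y\<in>{0..1}. \<bar>g k y - q y\<bar> < inverse (real (Suc k)))" for k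
    by (rule Stone_Weierstrass_real_polynomial_function[of "{0..1::real}" "g k" "inverse (real (Suc k))"])
       (auto simp: g_def intro!: continuous_intros)
  then obtain q where q: "\<And>k. real_polynomial_function (q k)"
     "\<And>k y. y \<in> {0..1} \<Longrightarrow> \<bar>g k y - q k y\<bar> < inverse (real (Suc k))"
    by metis
  show ?thesis
  proof
    show "real_polynomial_function (q k)" for k by (rule q)
    show "\<bar>q k y\<bar> \<le> 2" if "y \<in> {0..1}" for k y
    proof -
      have "inverse (real (Suc k)) \<le> 1" by (simp add: inverse_le_1_iff)
      moreover have "0 \<le> g k y" "g k y \<le> 1" by (auto simp: g_def)
      ultimately show ?thesis using q(2)[OF that, of k] by linarith
    qed
    show "(\<lambda>k. q k y) \<longlonglongrightarrow> indicator {c<..} y" if y: "y \<in> {0..1}" for y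
    proof -
      have "(\<lambda>k. g k y) \<longlonglongrightarrow> indicator {c<..} y"
      proof (cases "c < y")
        case True
        have "eventually (\<lambda>k. 1 \<le> real k * (y - c)) sequentially"
          using filterlim_at_top_mult_tendsto_pos[OF tendsto_const _ filterlim_real_sequentially, of "y - c"] True
          by (auto simp: filterlim_at_top)
        then have "eventually (\<lambda>k. g k y = 1) sequentially"
          by eventually_elim (use True in \<open>auto simp: g_def\<close>)
        then show ?thesis using True by (auto intro: tendsto_eventually)
      qed (simp add: g_def)
      moreover have "(\<lambda>k. g k y - q k y) \<longlonglongrightarrow> 0"
        by (rule Lim_null_comparison[OF _ LIMSEQ_inverse_real_of_nat])
           (use q(2)[OF y] in \<open>auto intro!: always_eventually less_imp_le\<close>)
      ultimately have "(\<lambda>k. g k y - (g k y - q k y)) \<longlonglongrightarrow> indicator {c<..} y - 0"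
        by (intro tendsto_diff)
      then show ?thesis by simp
    qed
  qed
qed

text \<open>The multiplicative form of the monotone class theorem. The class \<open>H\<close> of bounded \<open>h\<close> for which
  the integrals of all \<open>h e\<close> with \<open>e \<in> E\<close> agree is stable under multiplication by polynomials in
  \<open>e0 \<in> E\<close>, hence by the indicators of \<open>e0 > c\<close>, hence contains the indicators of an
  intersection-stable generator.\<close>
lemma prob_measure_eqI_multiplicative:
  fixes M N :: "'w measure" and E :: "('w \<Rightarrow> real) set"
  assumes "prob_space M" "prob_space N"
    and sets: "sets M = sigma_sets \<Omega> {{w\<in>\<Omega>. c < e w} | e c. e \<in> E}"
      "sets N = sigma_sets \<Omega> {{w\<in>\<Omega>. c < e w} | e c. e \<in> E}"
    and range: "\<And>e w. e \<in> E \<Longrightarrow> w \<in> \<Omega> \<Longrightarrow> e w \<in> {0..1}"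
    and one: "(\<lambda>w. 1) \<in> E"
    and mult: "\<And>e e'. e \<in> E \<Longrightarrow> e' \<in> E \<Longrightarrow> \<exists>e''\<in>E. \<forall>w\<in>\<Omega>. e'' w = e w * e' w"
    and eq: "\<And>e. e \<in> E \<Longrightarrow> (\<integral>w. e w \<partial>M) = (\<integral>w. e w \<partial>N)"
  shows "M = N"
proof -
  interpret M: prob_space M by fact
  interpret N: prob_space N by fact
  let ?G = "{{w\<in>\<Omega>. c < e w} | e c. e \<in> E}"
  have GP: "?G \<subseteq> Pow \<Omega>" by auto
  have MN: "sets N = sets M" using sets by simp
  have sp: "space M = \<Omega>" "space N = \<Omega>"
    using sets sets_eq_imp_space_eq[of _ "sigma \<Omega> ?G"]
    by (simp_all only: sets_measure_of[OF GP] space_measure_of[OF GP])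
  have meas: "e \<in> borel_measurable M" if "e \<in> E" for e
    unfolding borel_measurable_iff_greater sp sets using that by (auto intro!: sigma_sets.Basic)
  define H where "H = {h \<in> borel_measurable M. (\<forall>w\<in>\<Omega>. \<bar>h w\<bar> \<le> 1) \<and>
    (\<forall>e\<in>E. (\<integral>w. h w * e w \<partial>M) = (\<integral>w. h w * e w \<partial>N))}"
  have step: "(\<lambda>w. h w * indicator {w. c < e0 w} w) \<in> H" if h: "h \<in> H" and e0: "e0 \<in> E" for h c e0
  proof -
    note [measurable_cong] = MN
    have [measurable]: "h \<in> borel_measurable M" and hb: "\<And>w. w \<in> \<Omega> \<Longrightarrow> \<bar>h w\<bar> \<le> 1"
      using h by (auto simp: H_def)
    note [measurable] = meas[OF e0]
    obtain q :: "nat \<Rightarrow> real \<Rightarrow> real" where q: "\<And>k. real_polynomial_function (q k)"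
      "\<And>k y. y \<in> {0..1} \<Longrightarrow> \<bar>q k y\<bar> \<le> 2"
      "\<And>y. y \<in> {0..1} \<Longrightarrow> (\<lambda>k. q k y) \<longlonglongrightarrow> indicator {c<..} y"
      using polynomials_tendsto_indicator[of c] by blast
    have [measurable]: "q k \<in> borel_measurable borel" for k
      using q(1)[of k] unfolding real_polynomial_function_eq
      by (intro borel_measurable_continuous_onI continuous_on_polymonial_function) 
    have "(\<integral>w. h w * indicator {w. c < e0 w} w * e w \<partial>M)
        = (\<integral>w. h w * indicator {w. c < e0 w} w * e w \<partial>N)" if e: "e \<in> E" for e
    proof -
      note [measurable] = meas[OF e]
      have pow: "\<exists>e'\<in>E. \<forall>w\<in>\<Omega>. e' w = e0 w ^ i * e w" for i
      proof (induction i)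
        case 0
        then show ?case using e by auto
      next
        case (Suc i)
        then obtain e' where "e' \<in> E" "\<forall>w\<in>\<Omega>. e' w = e0 w ^ i * e w" by blast
        then show ?case using mult[OF e0 \<open>e' \<in> E\<close>] by (auto simp: mult_ac)
      qed
      have bnd: "\<bar>h w * q k (e0 w) * e w\<bar> \<le> 2" if "w \<in> \<Omega>" for w k
      proof -
        have "\<bar>h w\<bar> * \<bar>q k (e0 w)\<bar> * \<bar>e w\<bar> \<le> 1 * 2 * 1"
          using hb[OF that] q(2)[OF range[OF e0 that]] range[OF e that]
          by (intro mult_mono) auto
        then show ?thesis by (simp add: abs_mult)
      qed
      have lim: "(\<lambda>k. \<integral>w. h w * q k (e0 w) * e w \<partial>L) \<longlonglongrightarrow>
          (\<integral>w. h w * indicator {w. c < e0 w} w * e w \<partial>L)"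
        if "prob_space L" "sets L = sets M" for L
      proof -
        interpret L: prob_space L by fact
        have spL: "space L = \<Omega>" using sets_eq_imp_space_eq[OF that(2)] sp by simp
        note [measurable_cong] = that(2)
        show ?thesis
        proof (rule integral_dominated_convergence[where w = "\<lambda>_. 2"])
          have "(\<lambda>k. h w * q k (e0 w) * e w) \<longlonglongrightarrow> h w * indicator {w. c < e0 w} w * e w" if "w \<in> \<Omega>" for w
          proof -
            have "indicator {c<..} (e0 w) = (indicator {w. c < e0 w} w :: real)" by (auto simp: indicator_def)
            then show ?thesis using q(3)[OF range[OF e0 that]] by (intro tendsto_intros) auto
          qed
          then show "AE w in L. (\<lambda>k. h w * q k (e0 w) * e w) \<longlonglongrightarrow> h w * indicator {w. c < e0 w} w * e w"
            by (intro AE_I2) (simp add: spL)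
          show "AE w in L. norm (h w * q k (e0 w) * e w) \<le> 2" for k
            by (intro AE_I2) (use bnd in \<open>simp add: spL\<close>)
        qed measurable
      qed
      have "(\<integral>w. h w * q k (e0 w) * e w \<partial>M) = (\<integral>w. h w * q k (e0 w) * e w \<partial>N)" for k
      proof -
        obtain a n where an: "q k = (\<lambda>x. \<Sum>i\<le>n. a i * x ^ i)"
          using q(1)[of k] unfolding real_polynomial_function_iff_sum by blast
        have "(\<integral>w. h w * q k (e0 w) * e w \<partial>L) = (\<Sum>i\<le>n. a i * (\<integral>w. h w * (e0 w ^ i * e w) \<partial>L))"
          if "prob_space L" "sets L = sets M" for L
        proof -
          interpret L: prob_space L by fact
          have spL: "space L = \<Omega>" using sets_eq_imp_space_eq[OF that(2)] sp by simp
          note [measurable_cong] = that(2)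
          have "\<bar>h w * (e0 w ^ i * e w)\<bar> \<le> 1" if "w \<in> \<Omega>" for w i
          proof -
            have "\<bar>h w\<bar> * (\<bar>e0 w\<bar> ^ i * \<bar>e w\<bar>) \<le> 1 * (1 * 1)"
              using hb[OF that] range[OF e0 that] range[OF e that]
              by (intro mult_mono power_le_one) auto
            then show ?thesis by (simp add: abs_mult power_abs)
          qed
          then have "integrable L (\<lambda>w. h w * (e0 w ^ i * e w))" for i
            by (intro L.integrable_const_bound[where B = 1] AE_I2) (auto simp: spL)
          then show ?thesis by (simp add: an sum_distrib_left sum_distrib_right mult_ac)
        qed
        moreover have "(\<integral>w. h w * (e0 w ^ i * e w) \<partial>M) = (\<integral>w. h w * (e0 w ^ i * e w) \<partial>N)" for i
        proof -
          obtain e' where e': "e' \<in> E" "\<forall>w\<in>\<Omega>. e' w = e0 w ^ i * e w" using pow by blast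
          then have "(\<integral>w. h w * e' w \<partial>M) = (\<integral>w. h w * e' w \<partial>N)" using h by (auto simp: H_def)
          moreover have "(\<integral>w. h w * (e0 w ^ i * e w) \<partial>M) = (\<integral>w. h w * e' w \<partial>M)"
            "(\<integral>w. h w * (e0 w ^ i * e w) \<partial>N) = (\<integral>w. h w * e' w \<partial>N)"
            by (intro Bochner_Integration.integral_cong; use e' sp in simp)+
          ultimately show ?thesis by simp
        qed
        ultimately show ?thesis using M.prob_space_axioms N.prob_space_axioms MN by simp
      qed
      then show ?thesis
        using lim[OF M.prob_space_axioms refl] lim[OF N.prob_space_axioms MN]
        by (metis (no_types, lifting) LIMSEQ_unique ext)
    qed
    moreover have "(\<lambda>w. h w * indicator {w. c < e0 w} w) \<in> borel_measurable M"
    proof -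
      have "(\<lambda>w. h w * (if c < e0 w then 1 else 0)) \<in> borel_measurable M" by measurable
      then show ?thesis by (simp add: indicator_def if_distrib mult.commute)
    qed
    moreover have "\<bar>h w * indicator {w. c < e0 w} w\<bar> \<le> 1" if "w \<in> \<Omega>" for w
      using hb[OF that] by (auto simp: indicator_def)
    ultimately show ?thesis by (simp add: H_def)
  qed
  have H1: "(\<lambda>w. 1) \<in> H" using eq by (auto simp: H_def)
  have ind: "\<exists>h\<in>H. \<forall>w\<in>\<Omega>. h w = indicator (\<Inter>F) w" if "finite F" "F \<subseteq> ?G" for F
    using that
  proof (induction F)
    case empty
    then show ?case using H1 by auto
  next
    case (insert A F)
    then obtain h where h: "h \<in> H" "\<forall>w\<in>\<Omega>. h w = indicator (\<Inter>F) w" by auto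
    obtain e c where A: "A = {w\<in>\<Omega>. c < e w}" "e \<in> E" using insert by auto
    show ?case using step[OF h(1) A(2), of c] h(2) A(1)
      by (intro bexI[of _ "\<lambda>w. h w * indicator {w. c < e w} w"]) (auto simp: indicator_def)
  qed
  let ?E = "{\<Omega> \<inter> \<Inter>F | F. finite F \<and> F \<subseteq> ?G}"
  have sE: "sigma_sets \<Omega> ?E = sets M"
  proof (rule antisym)
    have "\<Omega> \<inter> \<Inter>F \<in> sets M" if F: "finite F" "F \<subseteq> ?G" for F
    proof -
      have "F \<subseteq> sets M" using F(2) sets(1) by (auto intro: sigma_sets.Basic)
      then show ?thesis using F(1) sets.top[of M] sp(1)
        sets.finite_INT[of F "\<lambda>A. A" M] by (cases "F = {}") auto
    qed
    then show "sigma_sets \<Omega> ?E \<subseteq> sets M"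
      using sets.sigma_sets_subset[of ?E M] sp(1) by blast
    have "?G \<subseteq> ?E"
    proof
      fix A assume "A \<in> ?G"
      then show "A \<in> ?E" using GP by (intro CollectI exI[of _ "{A}"]) auto
    qed
    then show "sets M \<subseteq> sigma_sets \<Omega> ?E" unfolding sets(1) by (rule sigma_sets_mono')
  qed
  show ?thesis
  proof (rule measure_eqI_generator_eq[where E = ?E and \<Omega> = \<Omega> and A = "\<lambda>_. \<Omega>"])
    show "Int_stable ?E"
    proof (rule Int_stableI)
      fix a b assume "a \<in> ?E" "b \<in> ?E"
      then obtain F F' where "a = \<Omega> \<inter> \<Inter>F" "b = \<Omega> \<inter> \<Inter>F'" "finite (F \<union> F')" "F \<union> F' \<subseteq> ?G" by auto
      then show "a \<inter> b \<in> ?E" by (intro CollectI exI[of _ "F \<union> F'"]) auto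
    qed
    show "emeasure M X = emeasure N X" if "X \<in> ?E" for X
    proof -
      obtain F where F: "X = \<Omega> \<inter> \<Inter>F" "finite F" "F \<subseteq> ?G" using \<open>X \<in> ?E\<close> by auto
      have X: "X \<in> sets M" unfolding sE[symmetric] using \<open>X \<in> ?E\<close> by (rule sigma_sets.Basic)
      obtain h where h: "h \<in> H" "\<forall>w\<in>\<Omega>. h w = indicator (\<Inter>F) w" using ind[OF F(2,3)] by blast
      have "(\<integral>w. h w * 1 \<partial>M) = (\<integral>w. h w * 1 \<partial>N)" using h(1) one unfolding H_def by auto
      moreover have "(\<integral>w. h w * 1 \<partial>M) = (\<integral>w. indicator X w \<partial>M)" "(\<integral>w. h w * 1 \<partial>N) = (\<integral>w. indicator X w \<partial>N)"
        by (intro Bochner_Integration.integral_cong; use h(2) sp F(1) in \<open>auto simp: indicator_def\<close>)+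
      moreover have "X \<inter> space M = X" "X \<inter> space N = X" using F(1) sp by auto
      ultimately have "measure M X = measure N X" using X MN by simp
      then show ?thesis by (simp add: M.emeasure_eq_measure N.emeasure_eq_measure)
    qed
    show "range (\<lambda>_. \<Omega>) \<subseteq> ?E" by (intro image_subsetI CollectI exI[of _ "{}"]) auto
  qed (use sE MN M.emeasure_finite in auto)
qed

text \<open>On the configuration space the functions \<open>\<omega> \<mapsto> exp (\<integral> f d\<omega>)\<close> with \<open>f \<le> 0\<close> form a
  multiplicative family, so the Laplace functional determines a probability measure.\<close>
theorem laplace_functional_unique:
  fixes \<mu> \<nu> :: "'a::metric_space set measure"
  assumes sc: "sigma_compact_space TYPE('a)"
    and P: "prob_space \<mu>" "prob_space \<nu>" and sets: "sets \<mu> = sets config_space" "sets \<nu> = sets config_space"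
    and eq: "\<And>f. f \<in> compactly_supported_continuous \<Longrightarrow> (\<And>x. f x \<le> 0) \<Longrightarrow>
      (\<integral>\<omega>. exp (config_int f \<omega>) \<partial>\<mu>) = (\<integral>\<omega>. exp (config_int f \<omega>) \<partial>\<nu>)"
  shows "\<mu> = \<nu>"
proof -
  let ?F = "{f :: 'a \<Rightarrow> real. f \<in> compactly_supported_continuous \<and> (\<forall>x. f x \<le> 0)}"
  let ?E = "(\<lambda>f \<omega>. exp (config_int f \<omega>)) ` ?F"
  have "{{w\<in>configurations. c < e w} | e c. e \<in> ?E} = laplace_sets \<union> {configurations}"
  proof (intro equalityI subsetI)
    fix A assume "A \<in> {{w\<in>configurations. c < e w} | e c. e \<in> ?E}"
    then obtain f c where A: "A = {w\<in>configurations. c < exp (config_int f w)}" "f \<in> ?F" by auto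
    show "A \<in> laplace_sets \<union> {configurations}"
    proof (cases "0 < c")
      case True
      then have "A = {w\<in>configurations. ln c < config_int f w}"
        unfolding A(1) by (metis exp_less_cancel_iff exp_ln)
      then show ?thesis using A(2) by (auto simp: laplace_sets_def)
    next
      case False
      then have "A = configurations" unfolding A(1) by (auto intro: le_less_trans[OF _ exp_gt_zero])
      then show ?thesis by simp
    qed
  next
    fix A assume "A \<in> laplace_sets \<union> {configurations :: 'a set set}"
    then consider f c where "A = {w\<in>configurations. c < config_int f w}" "f \<in> ?F" | "A = configurations"
      by (auto simp: laplace_sets_def)
    then show "A \<in> {{w\<in>configurations. c < e w} | e c. e \<in> ?E}"
    proof cases
      case (1 f c)
      then show ?thesis by (intro CollectI exI[of _ "\<lambda>\<omega>. exp (config_int f \<omega>)"] exI[of _ "exp c"]) auto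
    next
      case 2
      then show ?thesis using zero_compactly_supported_continuous
        by (intro CollectI exI[of _ "\<lambda>\<omega>. exp (config_int (\<lambda>x. 0) \<omega>)"] exI[of _ 0])
           (auto intro!: image_eqI[of _ _ "\<lambda>x. 0"])
    qed
  qed
  moreover have "sigma_sets configurations (laplace_sets \<union> {configurations}) = sigma_sets configurations (laplace_sets :: 'a set set set)"
    by (rule sigma_sets_eqI) (auto intro: sigma_sets.Basic sigma_sets_top)
  ultimately have gen: "sets config_space = sigma_sets configurations {{w\<in>configurations. c < e w} | e c. e \<in> ?E}"
    using sets_config_space_eq_laplace[OF sc] by simp
  show ?thesis
  proof (rule prob_measure_eqI_multiplicative[OF P, of configurations ?E])
    have nonpos: "config_int f \<omega> \<le> 0" if "f \<in> ?F" for f :: "'a \<Rightarrow> real" and \<omega>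
    proof -
      have "0 \<le> config_int (\<lambda>x. - f x) \<omega>" using that by (intro integral_nonneg_AE) auto
      then show ?thesis by simp
    qed
    show "e w \<in> {0..1}" if "e \<in> ?E" for e w using that nonpos by auto
    show "(\<lambda>w. 1) \<in> ?E"
      using zero_compactly_supported_continuous by (intro image_eqI[of _ _ "\<lambda>x. 0"]) auto
    show "(\<integral>w. e w \<partial>\<mu>) = (\<integral>w. e w \<partial>\<nu>)" if "e \<in> ?E" for e using that eq by auto
    show "\<exists>e''\<in>?E. \<forall>w\<in>configurations. e'' w = e w * e' w" if ee: "e \<in> ?E" "e' \<in> ?E" for e e'
    proof -
      obtain f f' where f: "f \<in> ?F" "e = (\<lambda>\<omega>. exp (config_int f \<omega>))"
        and f': "f' \<in> ?F" "e' = (\<lambda>\<omega>. exp (config_int f' \<omega>))" using ee by auto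
      have "(\<lambda>x. 1 * f x + f' x) \<in> ?F"
        using f(1) f'(1) compactly_supported_continuous_scale_add[of f f' 1] by (auto intro: add_nonpos_nonpos)
      moreover have "exp (config_int (\<lambda>x. 1 * f x + f' x) w) = e w * e' w" if "w \<in> configurations" for w
        using config_int_scale_add[OF that, of f f' 1] f f' by (simp add: exp_add)
      ultimately show ?thesis by (intro bexI[OF _ imageI]) auto
    qed
  qed (use gen sets in simp_all)
qed

section \<open>Radon measures on sigma-compact metric spaces\<close>

text \<open>If all balls around a point had infinite measure, they would contain compact sets of
  measure larger than every \<open>n\<close> that shrink to the point, and their union with the point would be
  compact.\<close>
lemma radon_measure_finite_ball:
  fixes x :: "'a::metric_space"
  assumes "radon_measure \<sigma>"
  shows "\<exists>r>0. emeasure \<sigma> (ball x r) < \<infinity>"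
proof (rule ccontr)
  assume "\<not> ?thesis"
  then have inf: "emeasure \<sigma> (ball x r) = \<infinity>" if "r > 0" for r
    using that by (metis infinity_ennreal_def less_top)
  have sets: "sets \<sigma> = sets borel" using assms by (simp add: radon_measure_def)
  have "\<exists>K. compact K \<and> K \<subseteq> ball x (inverse (real (Suc n))) \<and> of_nat n < emeasure \<sigma> K" for n
  proof -
    have "(SUP K\<in>{K. compact K \<and> K \<subseteq> ball x (inverse (real (Suc n)))}. emeasure \<sigma> K) = \<infinity>" (is "?S = _")
      using assms inf[of "inverse (real (Suc n))"] by (auto simp: radon_measure_def)
    have "of_nat n < ?S" unfolding \<open>?S = _\<close> by (simp add: of_nat_less_top)
    then show ?thesis unfolding less_SUP_iff by blast
  qed
  then obtain K where K: "\<And>n. compact (K n)" "\<And>n. K n \<subseteq> ball x (inverse (real (Suc n)))"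
    "\<And>n. of_nat n < emeasure \<sigma> (K n)" by metis
  let ?K = "insert x (\<Union>n. K n)"
  have "compact ?K" by (rule compact_insert_shrinking_compacts[OF K(1,2)])
  then have "emeasure \<sigma> ?K < \<infinity>" using assms by (auto simp: radon_measure_def)
  then obtain n where n: "emeasure \<sigma> ?K < of_nat n"
    using ennreal_Ex_less_of_nat[of "emeasure \<sigma> ?K"] by auto
  have "emeasure \<sigma> (K n) \<le> emeasure \<sigma> ?K"
    using \<open>compact ?K\<close> by (intro emeasure_mono) (auto simp: sets compact_imp_closed)
  then show False using n K(3)[of n] by auto
qed

text \<open>Finite unions of basic open sets of finite measure. Covering by open sets rather than compact
  ones matters: without local compactness, a compact set need not lie in a finite union of the
  compact sets that exhaust the space.\<close>
lemma radon_measure_exhaustion: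
  fixes \<sigma> :: "'a::metric_space measure"
  assumes sc: "sigma_compact_space TYPE('a)" and radon: "radon_measure \<sigma>"
  obtains V :: "nat \<Rightarrow> 'a set" where "\<forall>n. open (V n)" "\<forall>n. emeasure \<sigma> (V n) < \<infinity>"
    "\<forall>K. compact K \<longrightarrow> (\<exists>n. K \<subseteq> V n)"
proof -
  obtain B :: "'a set set" where B: "countable B" "topological_basis B"
    using sigma_compact_imp_countable_basis[OF sc] .
  have sets: "sets \<sigma> = sets borel" using radon by (simp add: radon_measure_def)
  define B0 where "B0 = {b\<in>B. emeasure \<sigma> b < \<infinity>}"
  have cov: "\<exists>b\<in>B0. x \<in> b" for x
  proof -
    obtain r where r: "r > 0" "emeasure \<sigma> (ball x r) < \<infinity>" using radon_measure_finite_ball[OF radon] by blast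
    obtain b where b: "b \<in> B" "x \<in> b" "b \<subseteq> ball x r"
      by (rule topological_basisE[OF B(2) open_ball[of x r]]) (use r in auto)
    have "emeasure \<sigma> b \<le> emeasure \<sigma> (ball x r)" by (intro emeasure_mono b) (simp add: sets)
    then show ?thesis using b r(2) unfolding B0_def by (auto intro: le_less_trans)
  qed
  have B0: "countable B0" "B0 \<noteq> {}" using B(1) cov by (auto simp: B0_def)
  have fni: "from_nat_into B0 i \<in> B0" for i using B0(2) by (rule from_nat_into)
  then have op: "open (from_nat_into B0 i)" for i
    using topological_basis_open[OF B(2)] by (auto simp: B0_def)
  define V where "V n = (\<Union>i\<le>n. from_nat_into B0 i)" for n
  have "open (V n)" for n using op by (auto simp: V_def)
  moreover have "emeasure \<sigma> (V n) < \<infinity>" for n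
    proof -
      have "emeasure \<sigma> (V n) \<le> (\<Sum>i\<le>n. emeasure \<sigma> (from_nat_into B0 i))"
        unfolding V_def by (rule emeasure_subadditive_finite) (auto simp: sets op)
      also have "\<dots> < \<infinity>" using fni by (auto simp: B0_def)
      finally show ?thesis .
    qed
  moreover have "\<exists>n. K \<subseteq> V n" if K: "compact K" for K
    proof -
      have "\<exists>i. x \<in> from_nat_into B0 i" for x
        using cov from_nat_into_surj[OF B0(1)] by metis
      then have cov_K: "K \<subseteq> (\<Union>i\<in>UNIV. from_nat_into B0 i)" by blast
      obtain I where I: "finite I" "K \<subseteq> (\<Union>i\<in>I. from_nat_into B0 i)"
        by (rule compactE_image[OF K, of UNIV "from_nat_into B0"]) (use op cov_K in auto)
      have "K \<subseteq> V (Max I)"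
      proof
        fix x assume "x \<in> K"
        then obtain i where "i \<in> I" "x \<in> from_nat_into B0 i" using I(2) by blast
        then show "x \<in> V (Max I)" using Max_ge[OF I(1)] unfolding V_def by blast
      qed
      then show ?thesis ..
    qed
  ultimately show ?thesis using that by blast
qed

lemma radon_measure_sigma_finite:
  fixes \<sigma> :: "'a::metric_space measure"
  assumes "sigma_compact_space TYPE('a)" and "radon_measure \<sigma>"
  shows "sigma_finite_measure \<sigma>"
proof -
  obtain K :: "nat \<Rightarrow> 'a set" where K: "\<And>n. compact (K n)" "(\<Union>n. K n) = UNIV"
    using assms(1) unfolding sigma_compact_space_def by blast
  have sets: "sets \<sigma> = sets borel" and fin: "\<And>n. emeasure \<sigma> (K n) < \<infinity>"
    using assms(2) K(1) by (auto simp: radon_measure_def)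
  have "range K \<subseteq> sets \<sigma>" using K(1) by (auto simp: sets compact_imp_closed)
  then show ?thesis using K(2) fin sets_eq_imp_space_eq[OF sets]
    by (intro sigma_finite_measure.intro exI[of _ "range K"]) (auto simp: less_top)
qed

text \<open>The complement is a countable union of products of disjoint basic open sets.\<close>
lemma diagonal_measurable:
  assumes "sigma_compact_space TYPE('a::metric_space)"
  shows "{(x, y). x = y} \<in> sets ((borel :: 'a measure) \<Otimes>\<^sub>M borel)"
proof -
  obtain B :: "'a set set" where B: "countable B" "topological_basis B"
    using sigma_compact_imp_countable_basis[OF assms] .
  let ?D = "\<Union>(b, c)\<in>{(b, c)\<in>B \<times> B. b \<inter> c = {}}. b \<times> c"
  have "?D \<in> sets (borel \<Otimes>\<^sub>M borel)"
  proof (rule sets.countable_UN')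
    have "countable (B \<times> B)" using B(1) by simp
    then show "countable {(b, c)\<in>B \<times> B. b \<inter> c = {}}" by (rule countable_subset[rotated]) auto
    show "(\<lambda>(b, c). b \<times> c) ` {(b, c)\<in>B \<times> B. b \<inter> c = {}} \<subseteq> sets (borel \<Otimes>\<^sub>M borel)"
      using topological_basis_open[OF B(2)] by auto
  qed
  moreover have "?D = UNIV - {(x, y). x = y}"
  proof (intro equalityI subsetI)
    fix z assume "z \<in> UNIV - {(x :: 'a, y). x = y}"
    then obtain x y where z: "z = (x, y)" "x \<noteq> y" by (cases z) auto
    then obtain U V where UV: "open U" "open V" "x \<in> U" "y \<in> V" "U \<inter> V = {}"
      using hausdorff by metis
    obtain b where "b \<in> B" "x \<in> b" "b \<subseteq> U" using topological_basisE[OF B(2) UV(1,3)] .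
    moreover obtain c where "c \<in> B" "y \<in> c" "c \<subseteq> V" using topological_basisE[OF B(2) UV(2,4)] .
    ultimately show "z \<in> ?D" using z UV(5) by blast
  qed blast
  ultimately have "UNIV - {(x :: 'a, y). x = y} \<in> sets (borel \<Otimes>\<^sub>M borel)" by simp
  then show ?thesis
    using sets.compl_sets[of "UNIV - {(x :: 'a, y). x = y}" "borel \<Otimes>\<^sub>M borel"]
    by (simp add: space_pair_measure double_diff)
qed

section \<open>Poisson processes as superpositions of independent samples\<close>

lemma nn_integral_PiM_prod:
  assumes "\<And>i. prob_space (M i)" "finite J" "\<And>i. i \<in> J \<Longrightarrow> f i \<in> borel_measurable (M i)"
  shows "(\<integral>\<^sup>+w. (\<Prod>i\<in>J. f i (w i)) \<partial>PiM UNIV M) = (\<Prod>i\<in>J. \<integral>\<^sup>+x. f i x \<partial>M i)"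
proof -
  interpret product_prob_space M UNIV
    using assms(1) by (simp add: product_prob_space_def product_sigma_finite_def product_prob_space_axioms_def prob_space_imp_sigma_finite)
  note [measurable] = assms(3)
  have [measurable]: "(\<lambda>w. \<Prod>i\<in>J. f i (w i)) \<in> borel_measurable (PiM J M)"
    by measurable
  have "(\<integral>\<^sup>+w. (\<Prod>i\<in>J. f i (w i)) \<partial>PiM UNIV M)
      = (\<integral>\<^sup>+w. (\<Prod>i\<in>J. f i (restrict w J i)) \<partial>PiM UNIV M)" by simp
  also have "\<dots> = (\<integral>\<^sup>+w. (\<Prod>i\<in>J. f i (w i)) \<partial>distr (PiM UNIV M) (PiM J M) (\<lambda>w. restrict w J))"
    by (subst nn_integral_distr) (auto intro!: measurable_restrict_subset)
  also have "\<dots> = (\<integral>\<^sup>+w. (\<Prod>i\<in>J. f i (w i)) \<partial>PiM J M)"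
    by (subst distr_PiM_restrict_finite[OF assms(2)]) auto
  also have "\<dots> = (\<Prod>i\<in>J. \<integral>\<^sup>+x. f i x \<partial>M i)"
    by (rule product_nn_integral_prod[OF assms(2,3)])
  finally show ?thesis .
qed

lemma distr_PiM_pair:
  assumes "\<And>i. prob_space (M i)" "i \<noteq> j"
  shows "distr (PiM UNIV M) (M i \<Otimes>\<^sub>M M j) (\<lambda>w. (w i, w j)) = M i \<Otimes>\<^sub>M M j"
proof -
  interpret product_prob_space M UNIV
    using assms(1) by (simp add: product_prob_space_def product_sigma_finite_def product_prob_space_axioms_def prob_space_imp_sigma_finite)
  show ?thesis
  proof (rule pair_measure_eqI[symmetric])
    fix A B assume AB: "A \<in> sets (M i)" "B \<in> sets (M j)"
    define X where "X k = (if k = i then A else B)" for k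
    have X: "X k \<in> sets (M k)" if "k \<in> {i, j}" for k using AB that by (auto simp: X_def)
    have "emeasure (distr (PiM UNIV M) (M i \<Otimes>\<^sub>M M j) (\<lambda>w. (w i, w j))) (A \<times> B)
       = emeasure (PiM UNIV M) {w\<in>space (PiM UNIV M). \<forall>k\<in>{i, j}. w k \<in> X k}"
      using AB assms(2) by (subst emeasure_distr) (auto intro!: arg_cong[where f = "emeasure _"] simp: X_def)
    also have "\<dots> = (\<Prod>k\<in>{i, j}. emeasure (M k) (X k))"
      by (rule emeasure_PiM_Collect) (use X in auto)
    also have "\<dots> = emeasure (M i) A * emeasure (M j) B" using assms(2) by (simp add: X_def)
    finally show "emeasure (M i) A * emeasure (M j) B =
      emeasure (distr (PiM UNIV M) (M i \<Otimes>\<^sub>M M j) (\<lambda>w. (w i, w j))) (A \<times> B)" by simp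
  qed (auto simp: assms(1) prob_space_imp_sigma_finite)
qed

lemma AE_pair_prob:
  assumes "prob_space M" "prob_space N"
    and "{z \<in> space (M \<Otimes>\<^sub>M N). P z} \<in> sets (M \<Otimes>\<^sub>M N)"
    and "AE x in M. AE y in N. P (x, y)"
  shows "AE z in M \<Otimes>\<^sub>M N. P z"
proof -
  interpret pair_sigma_finite M N
    by (intro pair_sigma_finite.intro prob_space_imp_sigma_finite assms)
  show ?thesis by (rule AE_pair_measure[OF assms(3,4)])
qed

lemma AE_PiM_pair:
  assumes "\<And>i. prob_space (M i)" "i \<noteq> j" "AE z in M i \<Otimes>\<^sub>M M j. P z"
  shows "AE w in PiM UNIV M. P (w i, w j)"
proof -
  have "AE z in distr (PiM UNIV M) (M i \<Otimes>\<^sub>M M j) (\<lambda>w. (w i, w j)). P z"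
    by (subst distr_PiM_pair[OF assms(1,2)]) (rule assms(3))
  then show ?thesis by (rule AE_distrD[rotated]) simp
qed

text \<open>A Poisson process whose intensity is the probability measure \<open>Z\<close>: a number of points with the
  Poisson distribution of rate 1, and an independent sequence of points with law \<open>Z\<close>, of which only
  the first ones, as many as the number says, count.\<close>
definition poisson_cell :: "'b measure \<Rightarrow> (nat \<times> (nat \<Rightarrow> 'b)) measure" where
  "poisson_cell Z = measure_pmf (poisson_pmf 1) \<Otimes>\<^sub>M PiM UNIV (\<lambda>_. Z)"

definition cell_sum :: "('b \<Rightarrow> 'c::comm_monoid_add) \<Rightarrow> nat \<times> (nat \<Rightarrow> 'b) \<Rightarrow> 'c" where
  "cell_sum F c = (\<Sum>i<fst c. F (snd c i))"

lemma prob_space_poisson_cell: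
  assumes "prob_space Z" shows "prob_space (poisson_cell Z)"
  unfolding poisson_cell_def
  by (intro prob_space_pair prob_space_PiM assms prob_space_measure_pmf)

lemma poisson_cell_measurable:
  assumes "\<And>k. (\<lambda>z. f (k, z)) \<in> measurable (PiM UNIV (\<lambda>_. Z)) N"
  shows "f \<in> measurable (poisson_cell Z) N"
proof -
  have "f \<in> measurable (count_space UNIV \<Otimes>\<^sub>M PiM UNIV (\<lambda>_. Z)) N"
    by (rule measurable_pair_measure_countable1) (use assms in auto)
  then show ?thesis unfolding poisson_cell_def
    by (simp cong: measurable_cong_sets add: measurable_pair_measure_countable1)
qed

lemma cell_sum_measurable:
  fixes F :: "'b \<Rightarrow> 'c::{comm_monoid_add, second_countable_topology, topological_comm_monoid_add}"
  assumes [measurable]: "F \<in> borel_measurable Z"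
  shows "cell_sum F \<in> borel_measurable (poisson_cell Z)"
  by (rule poisson_cell_measurable) (simp add: cell_sum_def)

lemma poisson_cell_point_measurable:
  "(\<lambda>c. snd c j) \<in> measurable (poisson_cell Z) Z"
  by (rule poisson_cell_measurable) simp

lemma nn_integral_poisson_cell:
  assumes Z: "prob_space Z" and f: "f \<in> borel_measurable (poisson_cell Z)"
  shows "(\<integral>\<^sup>+c. f c \<partial>poisson_cell Z) =
    (\<Sum>k. ennreal (exp (-1) / fact k) * (\<integral>\<^sup>+z. f (k, z) \<partial>PiM UNIV (\<lambda>_. Z)))"
proof -
  interpret prob_space "PiM UNIV (\<lambda>_::nat. Z)" by (intro prob_space_PiM Z)
  have "(\<integral>\<^sup>+c. f c \<partial>poisson_cell Z) = (\<integral>\<^sup>+k. \<integral>\<^sup>+z. f (k, z) \<partial>PiM UNIV (\<lambda>_. Z) \<partial>measure_pmf (poisson_pmf 1))"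
    using f unfolding poisson_cell_def by (subst nn_integral_fst[symmetric]) auto
  also have "\<dots> = (\<Sum>k. ennreal (exp (-1) / fact k) * (\<integral>\<^sup>+z. f (k, z) \<partial>PiM UNIV (\<lambda>_. Z)))"
    by (subst nn_integral_measure_pmf) (simp add: nn_integral_count_space_nat)
  finally show ?thesis .
qed

text \<open>Given that there are \<open>k\<close> points, independence yields \<open>a ^ k\<close> with \<open>a = \<integral> exp (- F) dZ\<close>; averaging
  over the Poisson distribution yields \<open>exp (a - 1)\<close>.\<close>
lemma laplace_poisson_cell:
  fixes F :: "'b \<Rightarrow> real"
  assumes Z: "prob_space Z" and F[measurable]: "F \<in> borel_measurable Z" and pos: "\<And>x. 0 \<le> F x"
  shows "(\<integral>\<^sup>+c. ennreal (exp (- cell_sum F c)) \<partial>poisson_cell Z)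
    = ennreal (exp (- (\<integral>x. 1 - exp (- F x) \<partial>Z)))"
proof -
  interpret Z: prob_space Z by fact
  have int: "integrable Z (\<lambda>x. exp (- F x))"
    by (rule Z.integrable_const_bound[where B = 1]) (use pos in auto)
  define a where "a = (\<integral>x. exp (- F x) \<partial>Z)"
  have a: "(\<integral>\<^sup>+x. ennreal (exp (- F x)) \<partial>Z) = ennreal a" "0 \<le> a"
    using int by (auto simp: a_def nn_integral_eq_integral)
  have m: "(\<lambda>c. ennreal (exp (- cell_sum F c))) \<in> borel_measurable (poisson_cell Z)"
    using cell_sum_measurable[OF F] by measurable
  have "(\<integral>\<^sup>+z. ennreal (exp (- cell_sum F (k, z))) \<partial>PiM UNIV (\<lambda>_. Z)) = ennreal (a ^ k)" for k
  proof -
    have "(\<integral>\<^sup>+z. ennreal (exp (- cell_sum F (k, z))) \<partial>PiM UNIV (\<lambda>_. Z))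
       = (\<integral>\<^sup>+z. (\<Prod>i\<in>{..<k}. ennreal (exp (- F (z i)))) \<partial>PiM UNIV (\<lambda>_. Z))"
      by (simp add: cell_sum_def sum_negf[symmetric] exp_sum prod_ennreal)
    also have "\<dots> = (\<Prod>i\<in>{..<k}. \<integral>\<^sup>+x. ennreal (exp (- F x)) \<partial>Z)"
      by (rule nn_integral_PiM_prod) (use Z in auto)
    also have "\<dots> = ennreal (a ^ k)" using a by (simp add: ennreal_power)
    finally show ?thesis .
  qed
  then have "(\<integral>\<^sup>+c. ennreal (exp (- cell_sum F c)) \<partial>poisson_cell Z)
     = (\<Sum>k. ennreal (exp (-1) * (inverse (fact k) * a ^ k)))"
    using a(2) by (subst nn_integral_poisson_cell[OF Z m])
      (simp add: ennreal_mult[symmetric] field_simps)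
  also have "\<dots> = ennreal (exp (-1) * exp a)"
    using sums_mult[OF exp_converges[of a], of "exp (-1)"] a(2)
    by (intro suminf_ennreal_eq) auto
  also have "exp (-1) * exp a = exp (- (\<integral>x. 1 - exp (- F x) \<partial>Z))"
    using int by (simp add: a_def exp_add[symmetric] Z.prob_space)
  finally show ?thesis .
qed

text \<open>Linearity of expectation; the expected number of points is 1.\<close>
lemma campbell_poisson_cell:
  fixes F :: "'b \<Rightarrow> ennreal"
  assumes Z: "prob_space Z" and F[measurable]: "F \<in> borel_measurable Z"
  shows "(\<integral>\<^sup>+c. cell_sum F c \<partial>poisson_cell Z) = (\<integral>\<^sup>+x. F x \<partial>Z)"
proof -
  interpret Z: prob_space Z by fact
  have "(\<integral>\<^sup>+z. cell_sum F (k, z) \<partial>PiM UNIV (\<lambda>_. Z)) = of_nat k * (\<integral>\<^sup>+x. F x \<partial>Z)" for k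
  proof -
    have "(\<integral>\<^sup>+z. F (z i) \<partial>PiM UNIV (\<lambda>_. Z)) = (\<integral>\<^sup>+x. F x \<partial>Z)" for i :: nat
      using nn_integral_PiM_prod[of "\<lambda>_. Z" "{i}" "\<lambda>_. F"] Z by simp
    then show ?thesis by (simp add: cell_sum_def nn_integral_sum)
  qed
  then have "(\<integral>\<^sup>+c. cell_sum F c \<partial>poisson_cell Z)
      = (\<Sum>k. ennreal (exp (-1) / fact k) * of_nat k * (\<integral>\<^sup>+x. F x \<partial>Z))"
    by (subst nn_integral_poisson_cell[OF Z cell_sum_measurable[OF F]]) (simp add: mult_ac)
  also have "\<dots> = (\<Sum>k. ennreal (exp (-1) / fact k) * of_nat k) * (\<integral>\<^sup>+x. F x \<partial>Z)"
    by (rule ennreal_suminf_multc)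
  also have "(\<Sum>k. ennreal (exp (-1) / fact k) * of_nat k) = (\<Sum>k. ennreal (exp (-1) / fact k * real k))"
    by (intro suminf_cong) (simp add: ennreal_of_nat_eq_real_of_nat ennreal_mult[symmetric])
  also have "\<dots> = ennreal 1"
  proof (rule suminf_ennreal_eq)
    have "(\<lambda>k. exp (-1) * (inverse (fact k) * 1 ^ k)) sums (exp (-1) * exp (1::real))"
      by (intro sums_mult) (use exp_converges[of "1::real"] in simp)
    also have "exp (-1) * exp (1::real) = 1" by (simp add: exp_minus)
    also have "(\<lambda>k. exp (-1) * (inverse (fact k) * 1 ^ k)) = (\<lambda>k. exp (-1) / fact (Suc k) * real (Suc k))"
      by (simp add: fun_eq_iff fact_Suc divide_inverse del: of_nat_Suc)
    finally show "(\<lambda>k. exp (-1) / fact k * real k) sums 1"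
      by (subst (asm) sums_Suc_iff) simp
  qed simp
  finally show ?thesis by simp
qed

text \<open>Superposition of independent cells: a Poisson process of intensity \<open>\<Sum>n. Z n\<close>.\<close>
definition point_process :: "(nat \<Rightarrow> 'b measure) \<Rightarrow> (nat \<Rightarrow> nat \<times> (nat \<Rightarrow> 'b)) measure" where
  "point_process Z = PiM UNIV (\<lambda>n. poisson_cell (Z n))"

lemma prob_space_point_process:
  "(\<And>n. prob_space (Z n)) \<Longrightarrow> prob_space (point_process Z)"
  unfolding point_process_def by (intro prob_space_PiM prob_space_poisson_cell)

lemma point_process_cell_measurable:
  "(\<lambda>w. w n) \<in> measurable (point_process Z) (poisson_cell (Z n))"
  unfolding point_process_def by measurable

lemma campbell_point_process:
  fixes F :: "'b \<Rightarrow> ennreal"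
  assumes Z: "\<And>n. prob_space (Z n)" and F: "\<And>n. F \<in> borel_measurable (Z n)"
  shows "(\<integral>\<^sup>+w. (\<Sum>n. cell_sum F (w n)) \<partial>point_process Z) = (\<Sum>n. \<integral>\<^sup>+x. F x \<partial>Z n)"
proof -
  have m: "(\<lambda>w. cell_sum F (w n)) \<in> borel_measurable (point_process Z)" for n
    by (rule measurable_compose[OF point_process_cell_measurable cell_sum_measurable[OF F]])
  have "(\<integral>\<^sup>+w. (\<Sum>n. cell_sum F (w n)) \<partial>point_process Z)
      = (\<Sum>n. \<integral>\<^sup>+w. cell_sum F (w n) \<partial>point_process Z)"
    by (rule nn_integral_suminf[OF m])
  moreover have "(\<integral>\<^sup>+w. cell_sum F (w n) \<partial>point_process Z) = (\<integral>\<^sup>+x. F x \<partial>Z n)" for n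
    using nn_integral_PiM_prod[of "\<lambda>n. poisson_cell (Z n)" "{n}" "\<lambda>_. cell_sum F"]
      campbell_poisson_cell[OF Z F] prob_space_poisson_cell[OF Z] cell_sum_measurable[OF F]
    by (simp add: point_process_def)
  ultimately show ?thesis by simp
qed

text \<open>The formula holds for finitely many cells by independence, and in the limit because the
  exponentials are bounded by 1.\<close>
lemma laplace_point_process:
  fixes F :: "'b \<Rightarrow> real"
  assumes Z: "\<And>n. prob_space (Z n)" and F: "\<And>n. F \<in> borel_measurable (Z n)" and pos: "\<And>x. 0 \<le> F x"
    and sm: "AE w in point_process Z. summable (\<lambda>n. cell_sum F (w n))"
    and c: "(\<Sum>n. \<integral>\<^sup>+x. ennreal (1 - exp (- F x)) \<partial>Z n) = ennreal c" "0 \<le> c"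
  shows "(\<integral>w. exp (- (\<Sum>n. cell_sum F (w n))) \<partial>point_process Z) = exp (- c)"
proof -
  interpret P: prob_space "point_process Z" by (rule prob_space_point_process[OF Z])
  have [measurable]: "(\<lambda>w. cell_sum F (w n)) \<in> borel_measurable (point_process Z)" for n
    by (rule measurable_compose[OF point_process_cell_measurable cell_sum_measurable[OF F]])
  have cpos: "0 \<le> cell_sum F d" for d by (auto simp: cell_sum_def intro: sum_nonneg pos)
  define b where "b n = (\<integral>x. 1 - exp (- F x) \<partial>Z n)" for n
  have b: "(\<integral>\<^sup>+x. ennreal (1 - exp (- F x)) \<partial>Z n) = ennreal (b n)" "0 \<le> b n" for n
  proof -
    interpret Zn: prob_space "Z n" by (rule Z)
    note [measurable] = F[of n]
    have "integrable (Z n) (\<lambda>x. 1 - exp (- F x))"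
      by (rule Zn.integrable_const_bound[where B = 1]) (use pos in auto)
    then show "(\<integral>\<^sup>+x. ennreal (1 - exp (- F x)) \<partial>Z n) = ennreal (b n)"
      unfolding b_def using pos by (intro nn_integral_eq_integral) auto
    show "0 \<le> b n" unfolding b_def using pos by (intro integral_nonneg_AE) auto
  qed
  have fin: "(\<integral>w. exp (- (\<Sum>n<k. cell_sum F (w n))) \<partial>point_process Z) = exp (- (\<Sum>n<k. b n))" for k
  proof -
    have "(\<integral>\<^sup>+w. ennreal (exp (- (\<Sum>n<k. cell_sum F (w n)))) \<partial>point_process Z)
        = (\<integral>\<^sup>+w. (\<Prod>n\<in>{..<k}. ennreal (exp (- cell_sum F (w n)))) \<partial>point_process Z)"
      by (simp add: sum_negf[symmetric] exp_sum prod_ennreal)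
    also have "\<dots> = (\<Prod>n\<in>{..<k}. \<integral>\<^sup>+c. ennreal (exp (- cell_sum F c)) \<partial>poisson_cell (Z n))"
      unfolding point_process_def
      by (rule nn_integral_PiM_prod)
         (use prob_space_poisson_cell[OF Z] cell_sum_measurable[OF F] in auto)
    also have "\<dots> = ennreal (exp (- (\<Sum>n<k. b n)))"
      using laplace_poisson_cell[OF Z F pos]
      by (simp add: b_def[symmetric] sum_negf[symmetric] exp_sum prod_ennreal)
    finally show ?thesis by (subst integral_eq_nn_integral) auto
  qed
  have "(\<lambda>k. \<integral>w. exp (- (\<Sum>n<k. cell_sum F (w n))) \<partial>point_process Z)
      \<longlonglongrightarrow> (\<integral>w. exp (- (\<Sum>n. cell_sum F (w n))) \<partial>point_process Z)"
  proof (rule integral_dominated_convergence[where w = "\<lambda>_. 1"])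
    show "AE w in point_process Z. (\<lambda>k. exp (- (\<Sum>n<k. cell_sum F (w n)))) \<longlonglongrightarrow> exp (- (\<Sum>n. cell_sum F (w n)))"
      using sm by eventually_elim (intro tendsto_intros summable_LIMSEQ)
    show "AE w in point_process Z. norm (exp (- (\<Sum>n<k. cell_sum F (w n)))) \<le> 1" for k
      by (intro AE_I2) (auto intro!: sum_nonneg cpos)
  qed auto
  moreover have "(\<lambda>k. exp (- (\<Sum>n<k. b n))) \<longlonglongrightarrow> exp (- c)"
  proof -
    have "(\<Sum>n. ennreal (b n)) = ennreal c" using c(1) b(1) by simp
    then have "b sums c"
      using b(2) c(2) by (metis ennreal_inj ennreal_neq_top suminf_ennreal2 suminf_nonneg summable_suminf_not_top sums_iff)
    then show ?thesis unfolding sums_def by (intro tendsto_intros)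
  qed
  ultimately show ?thesis unfolding fin by (rule LIMSEQ_unique)
qed

text \<open>Two different points are independent, so once the first is fixed the second almost surely
  avoids the section of \<open>R\<close> there. The case distinction is whether both points lie in one cell.\<close>
lemma point_process_AE_unrelated:
  assumes Z: "\<And>n. prob_space (Z n)" and S: "\<And>n. sets (Z n) = sets S"
    and R: "R \<in> sets (S \<Otimes>\<^sub>M S)"
    and null: "\<And>y n. y \<in> space S \<Longrightarrow> AE y' in Z n. (y, y') \<notin> R"
  shows "AE w in point_process Z. \<forall>n i m j. (n, i) \<noteq> (m, j) \<longrightarrow> (snd (w n) i, snd (w m) j) \<notin> R"
proof -
  have sp: "space (Z n) = space S" for n using sets_eq_imp_space_eq[OF S] .
  have pair: "AE (y, y') in Z n \<Otimes>\<^sub>M Z m. (y, y') \<notin> R" for n m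
  proof -
    have "sets (Z n \<Otimes>\<^sub>M Z m) = sets (S \<Otimes>\<^sub>M S)" by (rule sets_pair_measure_cong[OF S S])
    then have "{x \<in> space (Z n \<Otimes>\<^sub>M Z m). x \<notin> R} \<in> sets (Z n \<Otimes>\<^sub>M Z m)"
      using R by (metis Diff_eq set_diff_eq sets.compl_sets)
    then show ?thesis
      using AE_pair_prob[OF Z[of n] Z[of m], of "\<lambda>x. x \<notin> R"] AE_I2[of "Z n"] null
      by (simp add: sp split_beta')
  qed
  have point: "distr (poisson_cell (Z n)) (Z n) (\<lambda>c. snd c j) = Z n" for n j
  proof (rule measure_eqI)
    interpret prob_space "PiM UNIV (\<lambda>_::nat. Z n)" by (intro prob_space_PiM Z)
    fix A assume "A \<in> sets (distr (poisson_cell (Z n)) (Z n) (\<lambda>c. snd c j))"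
    then have A: "A \<in> sets (Z n)" by simp
    have "emeasure (distr (poisson_cell (Z n)) (Z n) (\<lambda>c. snd c j)) A
       = emeasure (poisson_cell (Z n)) (UNIV \<times> ((\<lambda>z. z j) -` A \<inter> space (PiM UNIV (\<lambda>_. Z n))))"
      using A poisson_cell_point_measurable
      by (subst emeasure_distr) (auto intro!: arg_cong[where f = "emeasure _"] simp: poisson_cell_def space_pair_measure)
    also have "\<dots> = emeasure (distr (PiM UNIV (\<lambda>_. Z n)) (Z n) (\<lambda>z. z j)) A"
      unfolding poisson_cell_def using A
      by (subst emeasure_pair_measure_Times) (auto simp: emeasure_distr measure_pmf.emeasure_space_1[simplified])
    also have "\<dots> = emeasure (Z n) A" by (subst distr_PiM_component) (use Z in auto)
    finally show "emeasure (distr (poisson_cell (Z n)) (Z n) (\<lambda>c. snd c j)) A = emeasure (Z n) A" .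
  qed simp
  have "AE w in point_process Z. (n, i) \<noteq> (m, j) \<longrightarrow> (snd (w n) i, snd (w m) j) \<notin> R" for n i m j
  proof (cases "n = m")
    case True
    have "AE c in poisson_cell (Z n). (snd c i, snd c j) \<notin> R" if "i \<noteq> j"
    proof -
      have "AE z in PiM UNIV (\<lambda>_. Z n). (z i, z j) \<notin> R"
        using AE_PiM_pair[of "\<lambda>_. Z n" i j "\<lambda>x. x \<notin> R"] Z that pair[of n n] by (simp add: split_beta')
      moreover have "{c \<in> space (poisson_cell (Z n)). (snd c i, snd c j) \<notin> R} \<in> sets (poisson_cell (Z n))"
      proof -
        have "(\<lambda>c. (snd c i, snd c j)) \<in> measurable (poisson_cell (Z n)) (S \<Otimes>\<^sub>M S)"
          using poisson_cell_point_measurable[of _ "Z n"] by (intro measurable_Pair) (simp_all cong: measurable_cong_sets add: S)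
        then show ?thesis using R by (intro predE pred_sets2) auto
      qed
      ultimately show ?thesis
        unfolding poisson_cell_def by (intro AE_pair_prob prob_space_PiM Z prob_space_measure_pmf) auto
    qed
    then show ?thesis unfolding point_process_def
      using True AE_PiM_component[of UNIV "\<lambda>n. poisson_cell (Z n)" n "\<lambda>c. (snd c i, snd c j) \<notin> R"]
        prob_space_poisson_cell[OF Z]
      by (cases "i = j") auto
  next
    case False
    have "(\<lambda>c. (snd (fst c) i, snd (snd c) j)) \<in> measurable (poisson_cell (Z n) \<Otimes>\<^sub>M poisson_cell (Z m)) (S \<Otimes>\<^sub>M S)"
      using poisson_cell_point_measurable[of _ "Z n"] poisson_cell_point_measurable[of _ "Z m"]
      by (intro measurable_Pair measurable_compose[OF measurable_fst] measurable_compose[OF measurable_snd])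
         (simp_all cong: measurable_cong_sets add: S)
    then have ms: "{c \<in> space (poisson_cell (Z n) \<Otimes>\<^sub>M poisson_cell (Z m)). (snd (fst c) i, snd (snd c) j) \<notin> R}
        \<in> sets (poisson_cell (Z n) \<Otimes>\<^sub>M poisson_cell (Z m))"
      using R by (intro predE pred_sets2) auto
    have "AE c in poisson_cell (Z n). AE c' in poisson_cell (Z m). (snd c i, snd c' j) \<notin> R"
    proof (rule AE_I2)
      fix c assume "c \<in> space (poisson_cell (Z n))"
      then have "snd c i \<in> space S"
        using measurable_space[OF poisson_cell_point_measurable[of i "Z n"]] by (simp add: sp)
      then show "AE c' in poisson_cell (Z m). (snd c i, snd c' j) \<notin> R"
        using null AE_distrD[OF poisson_cell_point_measurable[of j "Z m"], of "\<lambda>y'. (snd c i, y') \<notin> R", unfolded point]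
        by blast
    qed
    then have "AE c in poisson_cell (Z n) \<Otimes>\<^sub>M poisson_cell (Z m). (snd (fst c) i, snd (snd c) j) \<notin> R"
      by (intro AE_pair_prob prob_space_poisson_cell Z) (use ms in auto)
    then show ?thesis unfolding point_process_def
      using AE_PiM_pair[of "\<lambda>n. poisson_cell (Z n)" n m "\<lambda>c. (snd (fst c) i, snd (snd c) j) \<notin> R"]
        False prob_space_poisson_cell[OF Z]
      by simp
  qed
  then show ?thesis by (simp add: AE_all_countable)
qed

section \<open>Couplings\<close>

text \<open>The integral of a function that is not measurable is a supremum over measurable minorants, and
  minorants can be pulled back; equality may fail.\<close>
lemma nn_integral_distr_le:
  assumes T: "T \<in> measurable M N"
  shows "(\<integral>\<^sup>+y. f y \<partial>distr M N T) \<le> (\<integral>\<^sup>+x. f (T x) \<partial>M)"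
  unfolding nn_integral_def[of "distr M N T"]
proof (rule SUP_least)
  fix g assume "g \<in> {g. simple_function (distr M N T) g \<and> g \<le> f}"
  then have g: "simple_function (distr M N T) g" "\<And>y. g y \<le> f y" by (auto simp: le_fun_def)
  have "integral\<^sup>S (distr M N T) g = (\<integral>\<^sup>+y. g y \<partial>distr M N T)"
    by (rule nn_integral_eq_simple_integral[symmetric, OF g(1)])
  also have "\<dots> = (\<integral>\<^sup>+x. g (T x) \<partial>M)"
    using T borel_measurable_simple_function[OF g(1)] by (intro nn_integral_distr) auto
  also have "\<dots> \<le> (\<integral>\<^sup>+x. f (T x) \<partial>M)" by (intro nn_integral_mono g)
  finally show "integral\<^sup>S (distr M N T) g \<le> (\<integral>\<^sup>+x. f (T x) \<partial>M)" .
qed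

text \<open>Random elements on one probability space form a coupling through their joint law. As \<open>\<rho>\<close> is
  an arbitrary function, only one inequality of the change of variables is available, and it is
  the right one.\<close>
lemma rubinstein_dist_le:
  assumes P: "prob_space P" and X: "X \<in> measurable P \<mu>" "distr P \<mu> X = \<mu>"
    and Y: "Y \<in> measurable P \<nu>" "distr P \<nu> Y = \<nu>"
    and cost: "AE w in P. \<rho> (X w) (Y w) \<le> C w"
  shows "rubinstein_dist \<rho> \<mu> \<nu> \<le> (\<integral>\<^sup>+w. C w \<partial>P)"
proof -
  let ?T = "\<lambda>w. (X w, Y w)"
  let ?g = "distr P (\<mu> \<Otimes>\<^sub>M \<nu>) ?T"
  have T: "?T \<in> measurable P (\<mu> \<Otimes>\<^sub>M \<nu>)" using X(1) Y(1) by measurable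
  have "distr ?g \<mu> fst = distr P \<mu> X" "distr ?g \<nu> snd = distr P \<nu> Y"
    using T by (simp_all add: distr_distr comp_def)
  then have "?g \<in> couplings \<mu> \<nu>"
    using prob_space.prob_space_distr[OF P T] X(2) Y(2) by (simp add: couplings_def)
  then have "rubinstein_dist \<rho> \<mu> \<nu> \<le> (\<integral>\<^sup>+z. \<rho> (fst z) (snd z) \<partial>?g)"
    unfolding rubinstein_dist_def by (rule INF_lower)
  also have "\<dots> \<le> (\<integral>\<^sup>+w. \<rho> (X w) (Y w) \<partial>P)"
    using nn_integral_distr_le[OF T, of "\<lambda>z. \<rho> (fst z) (snd z)"] by simp
  also have "\<dots> \<le> (\<integral>\<^sup>+w. C w \<partial>P)" by (rule nn_integral_mono_AE[OF cost])
  finally show ?thesis .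
qed

section \<open>Counting and projecting the points of a process\<close>

definition point_indices :: "'b set \<Rightarrow> (nat \<Rightarrow> nat \<times> (nat \<Rightarrow> 'b)) \<Rightarrow> (nat \<times> nat) set" where
  "point_indices A w = {(n, i). i < fst (w n) \<and> snd (w n) i \<in> A}"

text \<open>Stated for finite sets of indices, it serves both to bound counts and to show that a finite
  sum forces finitely many indices.\<close>
lemma card_point_indices_le:
  assumes "finite J" "J \<subseteq> point_indices A w"
  shows "of_nat (card J) \<le> (\<Sum>n. cell_sum (indicator A :: _ \<Rightarrow> ennreal) (w n))"
proof -
  obtain N where N: "fst ` J \<subseteq> {..<N}" using assms(1) finite_nat_bounded[of "fst ` J"] by auto
  let ?S = "SIGMA n:{..<N}. {..<fst (w n)}"
  have sub: "J \<subseteq> ?S" using N assms(2) by (fastforce simp: point_indices_def)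
  have "of_nat (card J) = (\<Sum>(n, i)\<in>J. indicator A (snd (w n) i) :: ennreal)"
  proof -
    have "(\<Sum>(n, i)\<in>J. indicator A (snd (w n) i) :: ennreal) = (\<Sum>_\<in>J. 1)"
      by (rule sum.cong) (use assms(2) in \<open>auto simp: point_indices_def\<close>)
    then show ?thesis by simp
  qed
  also have "\<dots> \<le> (\<Sum>(n, i)\<in>?S. indicator A (snd (w n) i))"
    by (rule sum_mono2) (use sub in auto)
  also have "\<dots> = (\<Sum>n<N. cell_sum (indicator A) (w n))"
    by (simp add: cell_sum_def sum.Sigma[symmetric])
  also have "\<dots> \<le> (\<Sum>n. cell_sum (indicator A) (w n))"
    by (rule sum_le_suminf) auto
  finally show ?thesis .
qed

lemma finite_point_indices:
  assumes "(\<Sum>n. cell_sum (indicator A :: _ \<Rightarrow> ennreal) (w n)) < \<infinity>"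
  shows "finite (point_indices A w)"
proof (rule ccontr)
  assume inf: "infinite (point_indices A w)"
  obtain k where k: "(\<Sum>n. cell_sum (indicator A :: _ \<Rightarrow> ennreal) (w n)) < of_nat k"
    using ennreal_Ex_less_of_nat assms by auto
  obtain J where "finite J" "card J = k" "J \<subseteq> point_indices A w"
    using infinite_arbitrarily_large[OF inf] by blast
  then show False using card_point_indices_le[of J A w] k by auto
qed

lemma cell_sums_sums:
  fixes G :: "'b \<Rightarrow> real"
  assumes fin: "finite I" and I: "I \<subseteq> point_indices UNIV w"
    and out: "\<And>n i. (n, i) \<in> point_indices UNIV w \<Longrightarrow> (n, i) \<notin> I \<Longrightarrow> G (snd (w n) i) = 0"
  shows "(\<lambda>n. cell_sum G (w n)) sums (\<Sum>(n, i)\<in>I. G (snd (w n) i))"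
proof -
  obtain N where N: "fst ` I \<subseteq> {..<N}" using fin finite_nat_bounded[of "fst ` I"] by auto
  let ?S = "SIGMA n:{..<N}. {..<fst (w n)}"
  have sub: "I \<subseteq> ?S" using N I by (fastforce simp: point_indices_def)
  have "(\<lambda>n. cell_sum G (w n)) sums (\<Sum>n<N. cell_sum G (w n))"
  proof (rule sums_finite)
    fix n assume "n \<notin> {..<N}"
    then have "(n, i) \<notin> I" for i using N by force
    then show "cell_sum G (w n) = 0"
      unfolding cell_sum_def by (intro sum.neutral ballI out) (auto simp: point_indices_def)
  qed simp
  also have "(\<Sum>n<N. cell_sum G (w n)) = (\<Sum>(n, i)\<in>?S. G (snd (w n) i))"
    by (simp add: cell_sum_def sum.Sigma)
  also have "\<dots> = (\<Sum>(n, i)\<in>I. G (snd (w n) i))"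
    by (rule sum.mono_neutral_right) (use sub out in \<open>auto simp: point_indices_def\<close>)
  finally show ?thesis .
qed

definition projected_points :: "('a \<times> real) set \<Rightarrow> (nat \<Rightarrow> nat \<times> (nat \<Rightarrow> 'a \<times> real)) \<Rightarrow> 'a set" where
  "projected_points A w = (\<lambda>(n, i). fst (snd (w n) i)) ` point_indices A w"

text \<open>A point in exactly one of the two projections comes from a point of the process in the
  symmetric difference of the two regions.\<close>
lemma total_variation_projected_points_le:
  fixes w :: "nat \<Rightarrow> nat \<times> (nat \<Rightarrow> 'a::metric_space \<times> real)"
  shows "total_variation_dist (projected_points A w) (projected_points B w)
    \<le> (\<Sum>n. cell_sum (indicator (A - B \<union> (B - A))) (w n))"
  unfolding total_variation_dist_def measure_config_measure_singleton
proof (rule infsum_le_finite_sums)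
  let ?X = "projected_points A w" and ?Y = "projected_points B w"
  let ?D = "A - B \<union> (B - A)"
  fix F :: "'a set" assume F: "finite F"
  let ?G = "F \<inter> (?X - ?Y \<union> (?Y - ?X))"
  have "\<exists>j\<in>point_indices ?D w. (case j of (n, i) \<Rightarrow> fst (snd (w n) i)) = x" if "x \<in> ?G" for x
    using that by (fastforce simp: projected_points_def point_indices_def image_iff)
  then obtain j where j: "\<And>x. x \<in> ?G \<Longrightarrow> j x \<in> point_indices ?D w"
    "\<And>x. x \<in> ?G \<Longrightarrow> (case j x of (n, i) \<Rightarrow> fst (snd (w n) i)) = x" by metis
  have inj: "inj_on j ?G" by (rule inj_onI) (metis j(2))
  have "(\<Sum>x\<in>F. ennreal \<bar>indicator ?X x - indicator ?Y x\<bar>) = (\<Sum>x\<in>?G. 1)"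
    by (rule sum.mono_neutral_cong_right) (use F in \<open>auto simp: indicator_def\<close>)
  also have "\<dots> = of_nat (card (j ` ?G))" by (simp add: card_image[OF inj])
  also have "\<dots> \<le> (\<Sum>n. cell_sum (indicator ?D) (w n))"
    by (rule card_point_indices_le) (use F j(1) in auto)
  finally show "(\<Sum>x\<in>F. ennreal \<bar>indicator ?X x - indicator ?Y x\<bar>) \<le> (\<Sum>n. cell_sum (indicator ?D) (w n))" .
qed (simp add: nonneg_summable_on_complete)

section \<open>Poisson processes below graphs\<close>

text \<open>The Poisson process of intensity \<open>Q \<otimes> Lebesgue\<close> on the space times \<open>[0, \<infinity>)\<close>, where \<open>Q\<close> is a
  probability measure: cutting \<open>[0, \<infinity>)\<close> into unit intervals makes the intensity of each layer a
  probability measure.\<close>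
locale layered_process =
  fixes Q :: "'a::metric_space measure"
  assumes sigma_compact: "sigma_compact_space TYPE('a)"
    and prob_Q: "prob_space Q" and sets_Q: "sets Q = sets borel"
    and diffuse_Q: "diffuse Q"
begin

definition layer :: "nat \<Rightarrow> ('a \<times> real) measure" where
  "layer n = Q \<Otimes>\<^sub>M density lborel (indicator {real n..<real n + 1})"

definition process :: "(nat \<Rightarrow> nat \<times> (nat \<Rightarrow> 'a \<times> real)) measure" where
  "process = point_process layer"

lemma sets_layer[measurable_cong]: "sets (layer n) = sets (borel \<Otimes>\<^sub>M borel)"
  unfolding layer_def by (rule sets_pair_measure_cong) (simp_all add: sets_Q)

lemma prob_slab: "prob_space (density lborel (indicator {real n..<real n + 1}))"
  by (rule prob_spaceI) (simp add: emeasure_density)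

lemma prob_layer: "prob_space (layer n)"
  unfolding layer_def by (intro prob_space_pair prob_Q prob_slab)

lemma prob_process: "prob_space process"
  unfolding process_def by (rule prob_space_point_process[OF prob_layer])

lemma nn_integral_layers:
  fixes F :: "'a \<times> real \<Rightarrow> ennreal"
  assumes F[measurable]: "F \<in> borel_measurable (borel \<Otimes>\<^sub>M borel)"
  shows "(\<Sum>n. \<integral>\<^sup>+z. F z \<partial>layer n) = (\<integral>\<^sup>+x. \<integral>\<^sup>+u. F (x, u) * indicator {0..} u \<partial>lborel \<partial>Q)"
proof -
  note [measurable_cong] = sets_Q
  have "(\<integral>\<^sup>+z. F z \<partial>layer n) = (\<integral>\<^sup>+x. \<integral>\<^sup>+u. F (x, u) * indicator {real n..<real n + 1} u \<partial>lborel \<partial>Q)" for n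
  proof -
    interpret prob_space "density lborel (indicator {real n..<real n + 1})" by (rule prob_slab)
    have "(\<integral>\<^sup>+z. F z \<partial>layer n) = (\<integral>\<^sup>+x. \<integral>\<^sup>+u. F (x, u) \<partial>density lborel (indicator {real n..<real n + 1}) \<partial>Q)"
      unfolding layer_def by (subst nn_integral_fst[symmetric]) measurable
    then show ?thesis by (simp add: nn_integral_density mult.commute)
  qed
  moreover have "(\<Sum>n. F (x, u) * indicator {real n..<real n + 1} u) = F (x, u) * indicator {0..} u" for x u
  proof -
    have "indicator {real n..<real n + 1} u = (if 0 \<le> u \<and> n = nat \<lfloor>u\<rfloor> then 1 else 0 :: ennreal)" for n
      by (auto simp: indicator_def floor_eq_iff) linarith+
    then have "(\<Sum>n. F (x, u) * indicator {real n..<real n + 1} u)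
       = (\<Sum>n\<in>{nat \<lfloor>u\<rfloor>}. F (x, u) * indicator {real n..<real n + 1} u)"
      by (intro suminf_finite) auto
    also have "\<dots> = F (x, u) * indicator {0..} u"
      using \<open>indicator {real (nat \<lfloor>u\<rfloor>)..<real (nat \<lfloor>u\<rfloor>) + 1} u = _\<close> by (auto simp: indicator_def)
    finally show ?thesis .
  qed
  ultimately show ?thesis
    by (simp add: nn_integral_suminf[symmetric])
qed

text \<open>Below the graph of \<open>h\<close> the fibre over \<open>x\<close> has length \<open>h x\<close>, or 0 where \<open>h\<close> is negative, which is
  the value of \<open>ennreal (h x)\<close>.\<close>
lemma nn_integral_layers_subgraph:
  fixes F :: "'a \<Rightarrow> ennreal"
  assumes [measurable]: "F \<in> borel_measurable borel" "h \<in> borel_measurable borel"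
  shows "(\<Sum>n. \<integral>\<^sup>+z. indicator {(x, u). u < h x} z * F (fst z) \<partial>layer n)
    = (\<integral>\<^sup>+x. F x \<partial>density Q (\<lambda>x. ennreal (h x)))"
proof -
  note [measurable_cong] = sets_Q
  have [measurable]: "{(x, u). u < h x} \<in> sets (borel \<Otimes>\<^sub>M borel)"
  proof -
    have "{z\<in>space (borel \<Otimes>\<^sub>M borel). snd z < h (fst z)} \<in> sets (borel \<Otimes>\<^sub>M borel)" by measurable
    then show ?thesis by (simp add: space_pair_measure split_beta')
  qed
  have "(\<integral>\<^sup>+u. indicator {(x, u). u < h x} (x, u) * F x * indicator {0..} u \<partial>lborel) = ennreal (h x) * F x" for x
  proof -
    have "(\<integral>\<^sup>+u. indicator {(x, u). u < h x} (x, u) * F x * indicator {0..} u \<partial>lborel)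
       = (\<integral>\<^sup>+u. F x * indicator {0..<h x} u \<partial>lborel)"
      by (intro nn_integral_cong) (auto simp: indicator_def)
    also have "\<dots> = F x * ennreal (h x)"
      by (subst nn_integral_cmult_indicator) (cases "0 \<le> h x"; auto simp: ennreal_neg)+
    finally show ?thesis by (simp add: mult.commute)
  qed
  then show ?thesis
    by (subst nn_integral_layers) (simp_all add: nn_integral_density)
qed

definition distinct_points :: "(nat \<Rightarrow> nat \<times> (nat \<Rightarrow> 'a \<times> real)) \<Rightarrow> bool" where
  "distinct_points w \<longleftrightarrow> inj (\<lambda>(n, i). fst (snd (w n) i))"

lemma AE_distinct_points: "AE w in process. distinct_points w"
proof -
  let ?S = "borel \<Otimes>\<^sub>M borel :: ('a \<times> real) measure"
  let ?R = "{z\<in>space (?S \<Otimes>\<^sub>M ?S). (fst (fst z), fst (snd z)) \<in> {(x, y). x = y}}"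
  have "?R \<in> sets (?S \<Otimes>\<^sub>M ?S)"
    using diagonal_measurable[OF sigma_compact] by measurable
  moreover have "AE y' in layer n. (y, y') \<notin> ?R" for y n
  proof -
    have "AE x in Q. x \<noteq> fst y"
      using diffuse_Q sets_Q by (intro AE_I[where N = "{fst y}"]) (auto simp: diffuse_def)
    moreover have "{z\<in>space (layer n). fst z \<noteq> fst y} \<in> sets (layer n)"
    proof -
      have "fst \<in> measurable (layer n) borel" by measurable
      then have "fst -` (- {fst y}) \<inter> space (layer n) \<in> sets (layer n)" by (rule measurable_sets) simp
      also have "fst -` (- {fst y}) \<inter> space (layer n) = {z\<in>space (layer n). fst z \<noteq> fst y}" by auto
      finally show ?thesis .
    qed
    ultimately have "AE z in layer n. fst z \<noteq> fst y"
      unfolding layer_def by (intro AE_pair_prob prob_Q prob_slab) auto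
    then show ?thesis by eventually_elim auto
  qed
  ultimately have "AE w in process. \<forall>n i m j. (n, i) \<noteq> (m, j) \<longrightarrow> (snd (w n) i, snd (w m) j) \<notin> ?R"
    unfolding process_def by (intro point_process_AE_unrelated[OF prob_layer sets_layer])
  then show ?thesis
  proof eventually_elim
    case (elim w)
    have "(n, i) = (m, j)" if "fst (snd (w n) i) = fst (snd (w m) j)" for n i m j
    proof (rule ccontr)
      assume "(n, i) \<noteq> (m, j)"
      then show False using elim that by (simp add: space_pair_measure)
    qed
    then show ?case unfolding distinct_points_def by (intro injI) (auto split: prod.splits)
  qed
qed

text \<open>Projecting the points below the graph of \<open>h\<close> gives a Poisson process of intensity \<open>h Q\<close>. It is
  almost surely a configuration, since the expected number of points in each set of an open
  exhaustion of finite measure is finite, and no two points have the same projection. The law is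
  identified by its Laplace functional. On the exceptional null set \<open>N\<close> the configuration is taken
  to be empty, which makes \<open>\<Phi>\<close> a measurable map into the configurations.\<close>
lemma poisson_realisation:
  assumes h[measurable]: "h \<in> borel_measurable borel"
    and \<sigma>: "\<sigma> = density Q (\<lambda>x. ennreal (h x))" "radon_measure \<sigma>"
    and \<mu>: "poisson_measure \<sigma> \<mu>"
  shows "\<exists>\<Phi>. \<Phi> \<in> measurable process \<mu> \<and> distr process \<mu> \<Phi> = \<mu> \<and>
    (AE w in process. \<Phi> w = projected_points {(x, u). u < h x} w)"
proof -
  interpret prob_space process by (rule prob_process)
  let ?A = "{(x, u). u < h x}"
  have A[measurable]: "?A \<in> sets (borel \<Otimes>\<^sub>M borel)"
  proof -
    have "{z\<in>space (borel \<Otimes>\<^sub>M borel). snd z < h (fst z)} \<in> sets (borel \<Otimes>\<^sub>M borel)" by measurable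
    then show ?thesis by (simp add: space_pair_measure split_beta')
  qed
  obtain V :: "nat \<Rightarrow> 'a set" where V: "\<forall>k. open (V k)" "\<forall>k. emeasure \<sigma> (V k) < \<infinity>"
    "\<forall>K. compact K \<longrightarrow> (\<exists>k. K \<subseteq> V k)"
    using radon_measure_exhaustion[OF sigma_compact \<sigma>(2)] .
  have sets_\<sigma>: "sets \<sigma> = sets borel" using \<sigma>(2) by (simp add: radon_measure_def)
  have fin: "AE w in process. finite (point_indices (?A \<inter> V k \<times> UNIV) w)" for k
  proof -
    let ?F = "indicator (?A \<inter> V k \<times> UNIV) :: 'a \<times> real \<Rightarrow> ennreal"
    have [measurable]: "V k \<in> sets borel" using V(1) by simp
    have F: "?F \<in> borel_measurable (layer n)" for n by measurable
    have "(\<integral>\<^sup>+w. (\<Sum>n. cell_sum ?F (w n)) \<partial>process) = (\<Sum>n. \<integral>\<^sup>+z. ?F z \<partial>layer n)"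
      unfolding process_def by (rule campbell_point_process[OF prob_layer F])
    also have "\<dots> = (\<Sum>n. \<integral>\<^sup>+z. indicator ?A z * indicator (V k) (fst z) \<partial>layer n)"
      by (intro suminf_cong nn_integral_cong) (auto simp: indicator_def)
    also have "\<dots> = emeasure \<sigma> (V k)"
      by (subst nn_integral_layers_subgraph) (auto simp: \<sigma>(1)[symmetric] sets_\<sigma>)
    finally have "(\<integral>\<^sup>+w. (\<Sum>n. cell_sum ?F (w n)) \<partial>process) \<noteq> \<infinity>" using V(2) by simp (metis less_irrefl)
    moreover have "(\<lambda>w. cell_sum ?F (w n)) \<in> borel_measurable process" for n
      unfolding process_def
      by (rule measurable_compose[OF point_process_cell_measurable cell_sum_measurable[OF F]])
    then have "(\<lambda>w. \<Sum>n. cell_sum ?F (w n)) \<in> borel_measurable process" by measurable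
    ultimately have "AE w in process. (\<Sum>n. cell_sum ?F (w n)) \<noteq> \<infinity>"
      by (intro nn_integral_PInf_AE)
    then show ?thesis by eventually_elim (auto intro: finite_point_indices simp: less_top)
  qed
  have "AE w in process. distinct_points w \<and> (\<forall>k. finite (point_indices (?A \<inter> V k \<times> UNIV) w))"
    using AE_distinct_points fin by (simp add: AE_all_countable)
  then obtain N where N: "{w\<in>space process. \<not> (distinct_points w \<and> (\<forall>k. finite (point_indices (?A \<inter> V k \<times> UNIV) w)))} \<subseteq> N"
    "emeasure process N = 0" "N \<in> sets process" by (rule AE_E)
  have AE_N: "AE w in process. w \<notin> N" using N by (intro AE_not_in) auto
  have good: "distinct_points w" "\<And>k. finite (point_indices (?A \<inter> V k \<times> UNIV) w)"
    if "w \<in> space process" "w \<notin> N" for w using that N(1) by auto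
  define \<Phi> where "\<Phi> w = (if w \<in> N then {} else projected_points ?A w)" for w
  have conf: "\<Phi> w \<in> configurations" if "w \<in> space process" for w
  proof (cases "w \<in> N")
    case False
    have "finite (projected_points ?A w \<inter> K)" if K: "compact K" for K
    proof -
      obtain k where "K \<subseteq> V k" using V(3) K by blast
      then have "projected_points ?A w \<inter> K \<subseteq> (\<lambda>(n, i). fst (snd (w n) i)) ` point_indices (?A \<inter> V k \<times> UNIV) w"
        by (fastforce simp: projected_points_def point_indices_def image_iff)
      then show ?thesis using good(2)[OF \<open>w \<in> space process\<close> False, of k] by (rule finite_surj[rotated])
    qed
    then show ?thesis using False by (simp add: \<Phi>_def configurations_def)
  qed (simp add: \<Phi>_def configurations_def)
  \<comment> \<open>the sign makes the cell sums of \<open>G f\<close> nonnegative for \<open>f \<le> 0\<close>\<close>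
  define G where "G f z = indicator ?A z * - f (fst z)" for f :: "'a \<Rightarrow> real" and z
  have G[measurable]: "G f \<in> borel_measurable (borel \<Otimes>\<^sub>M borel)" if "f \<in> compactly_supported_continuous" for f
  proof -
    note [measurable] = compactly_supported_continuous_measurable[OF that]
    show ?thesis unfolding G_def by measurable
  qed
  have sums: "(\<lambda>n. cell_sum (G f) (w n)) sums (- config_int f (\<Phi> w))"
    if f: "f \<in> compactly_supported_continuous" and w: "w \<in> space process" "w \<notin> N" for f w
  proof -
    obtain K where K: "continuous_on UNIV f" "compact K" "{x. f x \<noteq> 0} \<subseteq> K"
      using f by (rule compactly_supported_continuousE)
    obtain k where k: "K \<subseteq> V k" using V(3) K(2) by blast
    let ?I = "point_indices (?A \<inter> V k \<times> UNIV) w"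
    have "(\<lambda>n. cell_sum (G f) (w n)) sums (\<Sum>(n, i)\<in>?I. G f (snd (w n) i))"
    proof (rule cell_sums_sums[OF good(2)[OF w]])
      show "G f (snd (w n) i) = 0" if "(n, i) \<in> point_indices UNIV w" "(n, i) \<notin> ?I" for n i
        using that K(3) k by (auto simp: G_def point_indices_def indicator_def)
    qed (auto simp: point_indices_def)
    also have "(\<Sum>(n, i)\<in>?I. G f (snd (w n) i)) = - (\<Sum>(n, i)\<in>?I. f (fst (snd (w n) i)))"
      unfolding sum_negf[symmetric] by (rule sum.cong) (auto simp: G_def point_indices_def indicator_def)
    also have "(\<Sum>(n, i)\<in>?I. f (fst (snd (w n) i))) = (\<Sum>x\<in>(\<lambda>(n, i). fst (snd (w n) i)) ` ?I. f x)"
      using good(1)[OF w] inj_on_subset[of _ UNIV ?I]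
      by (subst sum.reindex) (auto simp: distinct_points_def split_beta' intro!: sum.cong)
    also have "\<dots> = config_int f (\<Phi> w)"
    proof (rule config_int_eq_sum[symmetric, OF compactly_supported_continuous_measurable[OF f]])
      show "finite ((\<lambda>(n, i). fst (snd (w n) i)) ` ?I)" using good(2)[OF w, of k] by simp
      show "(\<lambda>(n, i). fst (snd (w n) i)) ` ?I \<subseteq> \<Phi> w"
        using w(2) by (auto simp: \<Phi>_def projected_points_def point_indices_def image_iff)
      fix x assume x: "x \<in> \<Phi> w" "f x \<noteq> 0"
      obtain n i where ni: "(n, i) \<in> point_indices ?A w" "x = fst (snd (w n) i)"
        using x(1) w(2) by (auto simp: \<Phi>_def projected_points_def)
      moreover have "x \<in> V k" using x(2) K(3) k by blast
      ultimately have "(n, i) \<in> ?I" by (auto simp: point_indices_def mem_Times_iff)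
      then show "x \<in> (\<lambda>(n, i). fst (snd (w n) i)) ` ?I"
        using ni(2) by (intro image_eqI[of _ _ "(n, i)"]) auto
    qed
    finally show ?thesis .
  qed
  have cell_meas: "(\<lambda>w. cell_sum (G f) (w n)) \<in> borel_measurable process"
    if f: "f \<in> compactly_supported_continuous" for f n
    unfolding process_def
    by (rule measurable_compose[OF point_process_cell_measurable cell_sum_measurable]) (use G[OF f] in measurable)
  have \<Phi>_int: "config_int f (\<Phi> w) = (if w \<in> N then 0 else - (\<Sum>n. cell_sum (G f) (w n)))"
    if "f \<in> compactly_supported_continuous" "w \<in> space process" for f w
  proof (cases "w \<in> N")
    case True
    then show ?thesis
      by (subst config_int_eq_sum[of f "{}"]) (auto simp: \<Phi>_def compactly_supported_continuous_measurable that)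
  next
    case False
    then show ?thesis using sums[OF that False] by (simp add: sums_iff)
  qed
  have int_meas: "(\<lambda>w. config_int f (\<Phi> w)) \<in> borel_measurable process"
    if f: "f \<in> compactly_supported_continuous" for f
  proof -
    note [measurable] = cell_meas[OF f] N(3)
    have "(\<lambda>w. if w \<in> N then 0 else - (\<Sum>n. cell_sum (G f) (w n))) \<in> borel_measurable process"
      by measurable
    then show ?thesis using \<Phi>_int[OF f] by (simp cong: measurable_cong)
  qed
  have \<Phi>[measurable]: "\<Phi> \<in> measurable process config_space"
  proof (rule measurable_sigma_sets[OF sets_config_space_eq_laplace[OF sigma_compact] laplace_sets_Pow])
    show "\<Phi> \<in> space process \<rightarrow> configurations" using conf by auto
    fix Y :: "'a set set" assume "Y \<in> laplace_sets"
    then obtain f c where Y: "Y = {\<omega>\<in>configurations. c < config_int f \<omega>}" "f \<in> compactly_supported_continuous"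
      by (auto simp: laplace_sets_def)
    note [measurable] = int_meas[OF Y(2)]
    have "\<Phi> -` Y \<inter> space process = {w\<in>space process. c < config_int f (\<Phi> w)}"
      using conf by (auto simp: Y(1))
    then show "\<Phi> -` Y \<inter> space process \<in> sets process" by simp
  qed
  have sets_\<mu>: "sets \<mu> = sets config_space" using \<mu> by (simp add: poisson_measure_def)
  have "distr process config_space \<Phi> = \<mu>"
  proof (rule laplace_functional_unique[OF sigma_compact])
    show "prob_space (distr process config_space \<Phi>)" by (rule prob_space_distr[OF \<Phi>])
    show "prob_space \<mu>" using \<mu> by (simp add: poisson_measure_def)
    show "sets \<mu> = sets config_space" by (rule sets_\<mu>)
    fix f :: "'a \<Rightarrow> real" assume f: "f \<in> compactly_supported_continuous" and neg: "\<And>x. f x \<le> 0"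
    obtain K where K: "continuous_on UNIV f" "compact K" "{x. f x \<noteq> 0} \<subseteq> K"
      using f by (rule compactly_supported_continuousE)
    have fm[measurable]: "f \<in> borel_measurable borel" by (rule compactly_supported_continuous_measurable[OF f])
    define c where "c = (\<integral>x. 1 - exp (f x) \<partial>\<sigma>)"
    have "integrable \<sigma> (\<lambda>x. 1 - exp (f x))"
    proof (rule Bochner_Integration.integrable_bound)
      show "integrable \<sigma> (indicator K :: 'a \<Rightarrow> real)"
        using \<sigma>(2) K(2) sets_\<sigma> by (auto simp: radon_measure_def compact_imp_closed)
      show "(\<lambda>x. 1 - exp (f x)) \<in> borel_measurable \<sigma>"
        using fm sets_\<sigma> by (simp cong: measurable_cong_sets)
      show "AE x in \<sigma>. norm (1 - exp (f x)) \<le> norm (indicator K x :: real)"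
      proof (rule AE_I2)
        fix x
        show "norm (1 - exp (f x)) \<le> norm (indicator K x :: real)"
          using neg[of x] K(3) by (cases "f x = 0") (auto simp: indicator_def)
      qed
    qed
    then have c: "(\<integral>\<^sup>+x. ennreal (1 - exp (f x)) \<partial>\<sigma>) = ennreal c" "0 \<le> c"
      unfolding c_def using neg by (auto intro!: nn_integral_eq_integral integral_nonneg_AE)
    have laplace: "(\<integral>w. exp (- (\<Sum>n. cell_sum (G f) (w n))) \<partial>process) = exp (- c)"
      unfolding process_def
    proof (rule laplace_point_process[OF prob_layer])
      show "G f \<in> borel_measurable (layer n)" for n using G[OF f] by measurable
      show "0 \<le> G f z" for z using neg by (auto simp: G_def indicator_def)
      show "AE w in point_process layer. summable (\<lambda>n. cell_sum (G f) (w n))"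
        unfolding process_def[symmetric] using AE_N AE_space
        by eventually_elim (use sums[OF f] in \<open>auto simp: sums_iff\<close>)
      have "(\<Sum>n. \<integral>\<^sup>+z. ennreal (1 - exp (- G f z)) \<partial>layer n)
         = (\<Sum>n. \<integral>\<^sup>+z. indicator ?A z * ennreal (1 - exp (f (fst z))) \<partial>layer n)"
        by (intro suminf_cong nn_integral_cong) (auto simp: G_def indicator_def)
      also have "\<dots> = (\<integral>\<^sup>+x. ennreal (1 - exp (f x)) \<partial>\<sigma>)"
        unfolding \<sigma>(1) by (rule nn_integral_layers_subgraph) auto
      finally show "(\<Sum>n. \<integral>\<^sup>+z. ennreal (1 - exp (- G f z)) \<partial>layer n) = ennreal c" using c(1) by simp
    qed (rule c(2))
    have "(\<integral>w. exp (- (\<Sum>n. cell_sum (G f) (w n))) \<partial>process) = (\<integral>w. exp (config_int f (\<Phi> w)) \<partial>process)"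
    proof (rule integral_cong_AE)
      show "AE w in process. exp (- (\<Sum>n. cell_sum (G f) (w n))) = exp (config_int f (\<Phi> w))"
        using AE_N AE_space by eventually_elim (simp add: \<Phi>_int[OF f])
    qed (use cell_meas[OF f] int_meas[OF f] in measurable)
    also have "\<dots> = (\<integral>\<omega>. exp (config_int f \<omega>) \<partial>distr process config_space \<Phi>)"
      using config_int_measurable[OF f] by (subst integral_distr[OF \<Phi>]) auto
    finally have "(\<integral>\<omega>. exp (config_int f \<omega>) \<partial>distr process config_space \<Phi>) = exp (- c)"
      using laplace by simp
    also have "- c = (\<integral>x. (exp (f x) - 1) \<partial>\<sigma>)"
      unfolding c_def by (subst Bochner_Integration.integral_minus[symmetric]) simp
    also have "exp \<dots> = (\<integral>\<omega>. exp (config_int f \<omega>) \<partial>\<mu>)"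
      using \<mu> f by (simp add: poisson_measure_def)
    finally show "(\<integral>\<omega>. exp (config_int f \<omega>) \<partial>distr process config_space \<Phi>) = (\<integral>\<omega>. exp (config_int f \<omega>) \<partial>\<mu>)" .
  qed simp
  moreover have "distr process \<mu> \<Phi> = distr process config_space \<Phi>"
    by (rule distr_cong) (simp_all add: sets_\<mu>)
  moreover have "\<Phi> \<in> measurable process \<mu>"
    using \<Phi> sets_\<mu> by (simp cong: measurable_cong_sets)
  moreover have "AE w in process. \<Phi> w = projected_points ?A w"
    using AE_N by eventually_elim (simp add: \<Phi>_def)
  ultimately show ?thesis by auto
qed

text \<open>Only an inequality, because the process lives above height 0 while \<open>h\<close> and \<open>k\<close> may be negative.\<close>
lemma nn_integral_layers_between_graphs:
  assumes [measurable]: "h \<in> borel_measurable borel" "k \<in> borel_measurable borel"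
  defines "A \<equiv> {(x, u). u < h x}" and "B \<equiv> {(x, u). u < k x}"
  shows "(\<integral>\<^sup>+w. (\<Sum>n. cell_sum (indicator (A - B \<union> (B - A))) (w n)) \<partial>process)
    \<le> (\<integral>\<^sup>+x. ennreal \<bar>h x - k x\<bar> \<partial>Q)"
proof -
  let ?D = "A - B \<union> (B - A)"
  have "A = {z\<in>space (borel \<Otimes>\<^sub>M borel). snd z < h (fst z)}" "B = {z\<in>space (borel \<Otimes>\<^sub>M borel). snd z < k (fst z)}"
    by (auto simp: A_def B_def space_pair_measure)
  then have [measurable]: "A \<in> sets (borel \<Otimes>\<^sub>M borel)" "B \<in> sets (borel \<Otimes>\<^sub>M borel)" by simp_all
  have "(\<integral>\<^sup>+w. (\<Sum>n. cell_sum (indicator ?D) (w n)) \<partial>process) = (\<Sum>n. \<integral>\<^sup>+z. indicator ?D z \<partial>layer n)"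
    unfolding process_def by (rule campbell_point_process[OF prob_layer]) measurable
  also have "\<dots> = (\<integral>\<^sup>+x. \<integral>\<^sup>+u. indicator ?D (x, u) * indicator {0..} u \<partial>lborel \<partial>Q)"
    by (rule nn_integral_layers) measurable
  also have "\<dots> \<le> (\<integral>\<^sup>+x. ennreal \<bar>h x - k x\<bar> \<partial>Q)"
  proof (rule nn_integral_mono)
    fix x
    have "(\<integral>\<^sup>+u. indicator ?D (x, u) * indicator {0..} u \<partial>lborel)
       \<le> (\<integral>\<^sup>+u. indicator {min (h x) (k x)..<max (h x) (k x)} u \<partial>lborel)"
      by (intro nn_integral_mono) (auto simp: indicator_def A_def B_def)
    also have "\<dots> = ennreal \<bar>h x - k x\<bar>" by (simp add: max_def min_def abs_if)
    finally show "(\<integral>\<^sup>+u. indicator ?D (x, u) * indicator {0..} u \<partial>lborel) \<le> ennreal \<bar>h x - k x\<bar>" .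
  qed
  finally show ?thesis .
qed

end

section \<open>The distance between Poisson measures\<close>

lemma total_variation_dist_self: "total_variation_dist \<omega> \<omega> = 0"
  by (simp add: total_variation_dist_def)

text \<open>Normalise a positive integrable function.\<close>
lemma obtain_equivalent_probability:
  assumes sf: "sigma_finite_measure M" and nz: "emeasure M (space M) \<noteq> 0"
  obtains Q and g :: "'a \<Rightarrow> real" where "prob_space Q" "sets Q = sets M"
    "null_sets M \<subseteq> null_sets Q" "g \<in> borel_measurable M" "\<forall>x. 0 \<le> g x" "M = density Q (\<lambda>x. ennreal (g x))"
proof -
  obtain f :: "'a \<Rightarrow> real" where f: "f \<in> borel_measurable M" "\<And>x. f x > 0" "integrable M f"
    using sigma_finite_measure.obtain_positive_integrable_function[OF sf] by metis
  note [measurable] = f(1)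
  define c where "c = (\<integral>x. f x \<partial>M)"
  have nn: "(\<integral>\<^sup>+x. ennreal (f x) \<partial>M) = ennreal c"
    unfolding c_def using f(2,3) by (intro nn_integral_eq_integral) (auto intro: less_imp_le)
  have "(\<integral>\<^sup>+x. ennreal (f x) \<partial>M) \<noteq> 0"
  proof
    assume "(\<integral>\<^sup>+x. ennreal (f x) \<partial>M) = 0"
    then have "AE x in M. ennreal (f x) = 0" by (subst (asm) nn_integral_0_iff_AE) auto
    then have "AE x in M. False" by (rule eventually_mono) (metis ennreal_eq_0_iff not_le f(2))
    then show False using nz by (simp add: AE_iff_null null_sets_def)
  qed
  then have c: "c > 0" using nn by (simp add: ennreal_eq_0_iff not_le)
  define Q where "Q = density M (\<lambda>x. ennreal (f x / c))"
  show ?thesis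
  proof
    show "prob_space Q"
    proof (rule prob_spaceI)
      have "emeasure Q (space Q) = (\<integral>\<^sup>+x. ennreal (f x) * ennreal (1 / c) \<partial>M)"
        unfolding Q_def using c f(2)
        by (auto simp: emeasure_density ennreal_mult[symmetric] less_imp_le intro!: nn_integral_cong)
      also have "\<dots> = ennreal c * ennreal (1 / c)" by (simp add: nn_integral_multc nn)
      also have "\<dots> = 1" using c by (simp add: ennreal_mult[symmetric])
      finally show "emeasure Q (space Q) = 1" .
    qed
    show "sets Q = sets M" by (simp add: Q_def)
    show "null_sets M \<subseteq> null_sets Q"
      unfolding Q_def using absolutely_continuousI_density[of "\<lambda>x. ennreal (f x / c)" M]
      by (simp add: absolutely_continuous_def)
    show "(\<lambda>x. c / f x) \<in> borel_measurable M" by measurable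
    show "\<forall>x. 0 \<le> c / f x" using c f(2) by (auto intro: less_imp_le)
    have "density Q (\<lambda>x. ennreal (c / f x)) = density M (\<lambda>x. ennreal (f x / c) * ennreal (c / f x))"
      unfolding Q_def by (rule density_density_eq) measurable
    also have "(\<lambda>x. ennreal (f x / c) * ennreal (c / f x)) = (\<lambda>x. 1)"
    proof
      fix x show "ennreal (f x / c) * ennreal (c / f x) = 1"
        using c f(2)[of x] by (simp add: ennreal_mult[symmetric])
    qed
    finally show "M = density Q (\<lambda>x. ennreal (c / f x))" by (simp add: density_1)
  qed
qed

theorem proposition4p1:
  fixes \<sigma> \<tau> :: "'a::metric_space measure"
    and \<mu>\<^sub>\<sigma> \<mu>\<^sub>\<tau> :: "'a set measure"
    and p :: "'a \<Rightarrow> real"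
  assumes "sigma_compact_space TYPE('a)"
    and "radon_measure \<sigma>" and "diffuse \<sigma>"
    and "radon_measure \<tau>" and "diffuse \<tau>"
    and "poisson_measure \<sigma> \<mu>\<^sub>\<sigma>" and "poisson_measure \<tau> \<mu>\<^sub>\<tau>"
    and "p \<in> borel_measurable \<sigma>" and "AE x in \<sigma>. 0 \<le> p x"
    and "\<tau> = density \<sigma> (\<lambda>x. ennreal (p x))"
    and "integrable \<sigma> (\<lambda>x. p x - 1)"
  shows "rubinstein_dist total_variation_dist \<mu>\<^sub>\<sigma> \<mu>\<^sub>\<tau> \<le> ennreal (\<integral>x. \<bar>p x - 1\<bar> \<partial>\<sigma>)"
proof (cases "emeasure \<sigma> (space \<sigma>) = 0")
  case True
  \<comment> \<open>no probability measure is equivalent to \<open>\<sigma> = 0\<close>; both Poisson measures coincide then\<close>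
  then have null: "AE x in \<sigma>. False" by (simp add: AE_iff_null null_sets_def)
  then have "AE x in \<tau>. False"
    unfolding \<open>\<tau> = _\<close> using \<open>p \<in> _\<close> by (subst AE_density) auto
  then have zero: "(\<integral>x. f x \<partial>\<sigma>) = 0" "(\<integral>x. f x \<partial>\<tau>) = 0" for f :: "'a \<Rightarrow> real"
    using null by (auto intro!: integral_eq_zero_AE elim: eventually_mono)
  note \<mu> = \<open>poisson_measure \<sigma> \<mu>\<^sub>\<sigma>\<close>[unfolded poisson_measure_def] \<open>poisson_measure \<tau> \<mu>\<^sub>\<tau>\<close>[unfolded poisson_measure_def]
  have "\<mu>\<^sub>\<sigma> = \<mu>\<^sub>\<tau>"
    by (rule laplace_functional_unique[OF \<open>sigma_compact_space _\<close>]) (use \<mu> zero in auto)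
  moreover have "rubinstein_dist total_variation_dist \<mu>\<^sub>\<sigma> \<mu>\<^sub>\<sigma> \<le> (\<integral>\<^sup>+\<omega>. 0 \<partial>\<mu>\<^sub>\<sigma>)"
    by (rule rubinstein_dist_le[where X = "\<lambda>\<omega>. \<omega>" and Y = "\<lambda>\<omega>. \<omega>"])
       (use \<mu> in \<open>auto simp: total_variation_dist_self distr_id\<close>)
  ultimately show ?thesis by simp
next
  case False
  have sets_\<sigma>: "sets \<sigma> = sets borel" using \<open>radon_measure \<sigma>\<close> by (simp add: radon_measure_def)
  obtain Q and g :: "'a \<Rightarrow> real" where Q: "prob_space Q" "sets Q = sets \<sigma>" "null_sets \<sigma> \<subseteq> null_sets Q"
    and g: "g \<in> borel_measurable \<sigma>" "\<forall>x. 0 \<le> g x" and \<sigma>: "\<sigma> = density Q (\<lambda>x. ennreal (g x))"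
    using obtain_equivalent_probability[OF radon_measure_sigma_finite[OF assms(1,2)] False] .
  have "{x} \<in> null_sets \<sigma>" for x
    using \<open>diffuse \<sigma>\<close> by (simp add: diffuse_def null_sets_def sets_\<sigma>)
  then have "{x} \<in> null_sets Q" for x using Q(3) by blast
  then have "diffuse Q" by (auto simp: diffuse_def null_sets_def)
  then interpret layered_process Q
    by (intro layered_process.intro) (use assms(1) Q(1,2) sets_\<sigma> in simp_all)
  have gm[measurable]: "g \<in> borel_measurable borel" and pm[measurable]: "p \<in> borel_measurable borel"
    using g(1) \<open>p \<in> borel_measurable \<sigma>\<close> sets_\<sigma> by (simp_all cong: measurable_cong_sets)
  have gpm: "(\<lambda>x. g x * p x) \<in> borel_measurable borel" by measurable
  note [measurable_cong] = sets_Q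
  have \<tau>: "\<tau> = density Q (\<lambda>x. ennreal (g x * p x))"
  proof -
    have "\<tau> = density Q (\<lambda>x. ennreal (g x) * ennreal (p x))"
      unfolding \<open>\<tau> = _\<close> by (subst (1) \<sigma>, rule density_density_eq) measurable
    then show ?thesis using g(2) by (simp add: ennreal_mult')
  qed
  \<comment> \<open>one process, read below the graphs of the densities of \<open>\<sigma>\<close> and \<open>\<tau>\<close> with respect to \<open>Q\<close>\<close>
  let ?A = "{(x, u). u < g x}" and ?B = "{(x, u). u < g x * p x}"
  obtain \<Phi> where \<Phi>: "\<Phi> \<in> measurable process \<mu>\<^sub>\<sigma>" "distr process \<mu>\<^sub>\<sigma> \<Phi> = \<mu>\<^sub>\<sigma>"
    "AE w in process. \<Phi> w = projected_points ?A w"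
    using poisson_realisation[OF gm \<sigma> \<open>radon_measure \<sigma>\<close> \<open>poisson_measure \<sigma> _\<close>] by blast
  obtain \<Psi> where \<Psi>: "\<Psi> \<in> measurable process \<mu>\<^sub>\<tau>" "distr process \<mu>\<^sub>\<tau> \<Psi> = \<mu>\<^sub>\<tau>"
    "AE w in process. \<Psi> w = projected_points ?B w"
    using poisson_realisation[OF gpm \<tau> \<open>radon_measure \<tau>\<close> \<open>poisson_measure \<tau> _\<close>] by blast
  have "rubinstein_dist total_variation_dist \<mu>\<^sub>\<sigma> \<mu>\<^sub>\<tau>
      \<le> (\<integral>\<^sup>+w. (\<Sum>n. cell_sum (indicator (?A - ?B \<union> (?B - ?A))) (w n)) \<partial>process)"
  proof (rule rubinstein_dist_le[OF prob_process \<Phi>(1,2) \<Psi>(1,2)])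
    show "AE w in process. total_variation_dist (\<Phi> w) (\<Psi> w)
        \<le> (\<Sum>n. cell_sum (indicator (?A - ?B \<union> (?B - ?A))) (w n))"
      using \<Phi>(3) \<Psi>(3) by eventually_elim (simp only: total_variation_projected_points_le)
  qed
  also have "\<dots> \<le> (\<integral>\<^sup>+x. ennreal \<bar>g x - g x * p x\<bar> \<partial>Q)"
    by (rule nn_integral_layers_between_graphs) measurable
  also have "\<dots> = (\<integral>\<^sup>+x. ennreal (g x) * ennreal \<bar>p x - 1\<bar> \<partial>Q)"
  proof (intro nn_integral_cong)
    fix x
    have "\<bar>g x - g x * p x\<bar> = g x * \<bar>p x - 1\<bar>"
      using spec[OF g(2), of x] by (simp add: abs_mult_pos' right_diff_distrib abs_minus_commute)
    then show "ennreal \<bar>g x - g x * p x\<bar> = ennreal (g x) * ennreal \<bar>p x - 1\<bar>"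
      using spec[OF g(2), of x] by (simp add: ennreal_mult)
  qed
  also have "\<dots> = (\<integral>\<^sup>+x. ennreal \<bar>p x - 1\<bar> \<partial>\<sigma>)"
    by (subst \<sigma>, subst nn_integral_density) measurable
  also have "\<dots> = ennreal (\<integral>x. \<bar>p x - 1\<bar> \<partial>\<sigma>)"
    using \<open>integrable \<sigma> _\<close> by (intro nn_integral_eq_integral) auto
  finally show ?thesis .
qed

end
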